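(* Let $G$ be a graph with $m$ edges and $T$ triangles, received as a stream of edges, and let $\epsilon>0$. There is a single-pass sampling algorithm which takes as input $\epsilon$, $\delta\in(0,1)$ and a number $\widetilde{T}>0$ (and, following the standing convention below, the graph parameters it uses up to constant factors) with the following guarantee. If $\widetilde{T}\le T$, it outputs an estimate within $(1\pm\epsilon)T$ with probability at least $1-\delta$, while keeping \[ O\!\left(\frac{m\log\frac{1}{\delta}}{\epsilon^2}\left(\frac{1}{\widetilde{T}^{2/3}}+\frac{\sqrt{\Delta_{V,\epsilon/24}}\log\widetilde{T}}{\widetilde{T}}+\frac{\Delta_{E,\epsilon/24}\log\widetilde{T}}{\widetilde{T}}\right)\right) \] edges. If $\widetilde{T}>T$, then with probability at least $1-\delta$ the algorithm either determines that $\widetilde{T}>T$ or outputs a $(1\pm\epsilon)$-approximation to $T$.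
   Context: For a vertex $v$, $T_v$ is the number of triangles of $G$ containing $v$; for an edge $e$, $T_e$ is the number of triangles containing $e$. For $\eta>0$: order the vertices as $(v_i)_{i\ge0}$ in descending order of $T_v$ and the edges as $(e_i)_{i\ge0}$ in descending order of $T_e$; let $H_V$, $H_E$ be the maximal prefixes of these sequences with $\sum_{v\in H_V}T_v\le \eta T$ and $\sum_{e\in H_E}T_e\le\eta T$. Define $\Delta_{V,\eta}=\max_{v\notin H_V}T_v$ and $\Delta_{E,\eta}=\max_{e\notin H_E}T_e$. In the (nonadaptive) sampling model, an algorithm chooses a distribution over sets $S$ of vertex pairs independent of the input and receives $E(G)\cap S$, paying $\mathbb{E}|E(G)\cap S|$ samples. Standing convention: an algorithm whose sampling rates depend on graph parameters is assumed to know those parameters up to constant factors.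
   Formalization: In the bound on the number of kept edges, log T̃ is read as log max(1, T̃); this differs only for T̃ < 1, where the literal bound can be negative and hence impossible to meet. *)

theory Defs
  imports "HOL-Probability.Probability" "HOL-Library.Multiset"
begin

section \<open>Graphs and triangles\<close>

definition vertex_pairs :: "'v set \<Rightarrow> 'v set set" where
  "vertex_pairs V = {e. e \<subseteq> V \<and> card e = 2}"

definition simple_graph :: "'v set \<Rightarrow> 'v set set \<Rightarrow> bool" where
  "simple_graph V E \<longleftrightarrow> finite V \<and> E \<subseteq> vertex_pairs V"

definition triangles :: "'v set \<Rightarrow> 'v set set \<Rightarrow> 'v set set" where
  "triangles V E = {t. t \<subseteq> V \<and> card t = 3 \<and> vertex_pairs t \<subseteq> E}"

definition num_triangles :: "'v set \<Rightarrow> 'v set set \<Rightarrow> nat" where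
  "num_triangles V E = card (triangles V E)"

definition vertex_triangles :: "'v set \<Rightarrow> 'v set set \<Rightarrow> 'v \<Rightarrow> nat" where
  "vertex_triangles V E v = card {t \<in> triangles V E. v \<in> t}"

definition edge_triangles :: "'v set \<Rightarrow> 'v set set \<Rightarrow> 'v set \<Rightarrow> nat" where
  "edge_triangles V E e = card {t \<in> triangles V E. e \<subseteq> t}"


section \<open>Heavy prefixes and the parameters \<open>\<Delta>\<^sub>V\<close>, \<open>\<Delta>\<^sub>E\<close>\<close>

definition descending_order :: "('a \<Rightarrow> nat) \<Rightarrow> 'a set \<Rightarrow> 'a list \<Rightarrow> bool" where
  "descending_order w X xs \<longleftrightarrow>
     distinct xs \<and> set xs = X \<and> sorted_wrt (\<lambda>x y. w y \<le> w x) xs"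

text \<open>The longest prefix of \<open>xs\<close> whose total weight is at most \<open>b\<close> (for \<open>b \<ge> 0\<close>).\<close>

definition heavy_prefix :: "('a \<Rightarrow> nat) \<Rightarrow> real \<Rightarrow> 'a list \<Rightarrow> 'a list" where
  "heavy_prefix w b xs =
     take (Max {k. k \<le> length xs \<and> real (sum_list (map w (take k xs))) \<le> b}) xs"

text \<open>The maximum over an empty set of light elements is \<open>0\<close>.\<close>

definition max_light_of :: "('a \<Rightarrow> nat) \<Rightarrow> real \<Rightarrow> 'a list \<Rightarrow> nat" where
  "max_light_of w b xs =
     (let L = set xs - set (heavy_prefix w b xs)
      in if L = {} then 0 else Max (w ` L))"

text \<open>Ties make the descending order non-unique, but the resulting value does not
  depend on the order chosen; see \<open>max_light_eq\<close> below.\<close>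

definition max_light :: "('a \<Rightarrow> nat) \<Rightarrow> real \<Rightarrow> 'a set \<Rightarrow> nat" where
  "max_light w b X = max_light_of w b (SOME xs. descending_order w X xs)"

definition Delta_V :: "'v set \<Rightarrow> 'v set set \<Rightarrow> real \<Rightarrow> nat" where
  "Delta_V V E \<eta> = max_light (vertex_triangles V E) (\<eta> * real (num_triangles V E)) V"

definition Delta_E :: "'v set \<Rightarrow> 'v set set \<Rightarrow> real \<Rightarrow> nat" where
  "Delta_E V E \<eta> = max_light (edge_triangles V E) (\<eta> * real (num_triangles V E)) E"

lemma descending_order_map_unique:
  assumes "descending_order w X xs" "descending_order w X ys"
  shows "map w xs = map w ys"
proof -
  have s: "sorted (rev (map w zs))" if "descending_order w X zs" for zs
    using that by (simp add: descending_order_def rev_map[symmetric] sorted_wrt_rev sorted_wrt_map)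
  have "mset xs = mset ys"
    using assms by (metis descending_order_def set_eq_iff_mset_eq_distinct)
  hence "mset (rev (map w xs)) = mset (rev (map w ys))" by simp
  hence "rev (map w xs) = rev (map w ys)"
    using s[OF assms(1)] s[OF assms(2)] by (metis properties_for_sort)
  thus ?thesis by simp
qed

lemma max_light_of_eq:
  assumes "distinct xs"
  shows "max_light_of w b xs =
    (let ws = map w xs; L = set (drop (Max {k. k \<le> length ws \<and> real (sum_list (take k ws)) \<le> b}) ws)
     in if L = {} then 0 else Max L)"
proof -
  have "set xs - set (take k xs) = set (drop k xs)" for k
  proof -
    have "set xs = set (take k xs) \<union> set (drop k xs)"
      by (metis append_take_drop_id set_append)
    moreover have "set (take k xs) \<inter> set (drop k xs) = {}"
      using assms by (simp add: set_take_disj_set_drop_if_distinct)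
    ultimately show ?thesis by blast
  qed
  thus ?thesis
    by (simp add: max_light_of_def heavy_prefix_def Let_def take_map drop_map)
qed

lemma max_light_eq:
  assumes "descending_order w X xs"
  shows "max_light w b X = max_light_of w b xs"
proof -
  let ?ys = "SOME xs. descending_order w X xs"
  have ys: "descending_order w X ?ys" using assms by (rule someI)
  show ?thesis
    using descending_order_map_unique[OF ys assms] ys assms
    by (simp add: max_light_def max_light_of_eq descending_order_def)
qed

lemma descending_order_exists:
  assumes "finite X"
  shows "\<exists>xs. descending_order w X xs"
proof -
  obtain ys where ys: "set ys = X" "distinct ys"
    using finite_distinct_list[OF assms] by blast
  let ?zs = "rev (sort_key w ys)"
  have "sorted (map w (sort_key w ys))" by simp
  hence "descending_order w X ?zs"
    using ys by (simp add: descending_order_def sorted_wrt_rev sorted_wrt_map)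
  thus ?thesis by blast
qed


section \<open>Nonadaptive single-pass sampling algorithms\<close>

datatype outcome = Estimate real | Guess_Too_Large

text \<open>A randomized algorithm is a distribution, fixed before any edge is seen, over pairs
  \<open>(S, g)\<close>: the set \<open>S\<close> of vertex pairs to be sampled together with the rule \<open>g\<close> computing
  the outcome from the sampled edges. Drawing them jointly lets \<open>g\<close> use the internal
  randomness that produced \<open>S\<close>.\<close>

type_synonym 'v sampler = "('v set set \<times> ('v set set \<Rightarrow> outcome)) pmf"

definition sampler_on :: "'v set \<Rightarrow> 'v sampler \<Rightarrow> bool" where
  "sampler_on V A \<longleftrightarrow> (\<forall>(S, g) \<in> set_pmf A. S \<subseteq> vertex_pairs V)"

definition edge_stream :: "'v set set \<Rightarrow> 'v set list \<Rightarrow> bool" where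
  "edge_stream E es \<longleftrightarrow> distinct es \<and> set es = E"

definition kept_edges :: "'v set set \<Rightarrow> 'v set list \<Rightarrow> 'v set list" where
  "kept_edges S es = filter (\<lambda>e. e \<in> S) es"

definition outcome_pmf :: "'v sampler \<Rightarrow> 'v set list \<Rightarrow> outcome pmf" where
  "outcome_pmf A es = map_pmf (\<lambda>(S, g). g (set (kept_edges S es))) A"

definition expected_kept :: "'v sampler \<Rightarrow> 'v set list \<Rightarrow> real" where
  "expected_kept A es = measure_pmf.expectation A (\<lambda>(S, g). real (length (kept_edges S es)))"

definition accurate :: "real \<Rightarrow> real \<Rightarrow> outcome set" where
  "accurate \<epsilon> t = {Estimate r | r. (1 - \<epsilon>) * t \<le> r \<and> r \<le> (1 + \<epsilon>) * t}"

definition within_factor :: "real \<Rightarrow> real \<Rightarrow> real \<Rightarrow> bool" where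
  "within_factor \<kappa> x y \<longleftrightarrow> x / \<kappa> \<le> y \<and> y \<le> \<kappa> * x"

text \<open>The factor \<open>log T\<close> of the guess \<open>T\<close> is read as \<open>ln (max 1 T)\<close>: this is \<open>ln T\<close> for
  \<open>T \<ge> 1\<close>, and it prevents the bound from becoming negative for \<open>T < 1\<close>.\<close>

definition sample_bound :: "real \<Rightarrow> real \<Rightarrow> real \<Rightarrow> real \<Rightarrow> real \<Rightarrow> real \<Rightarrow> real" where
  "sample_bound m \<epsilon> \<delta> T dV dE =
     m * ln (1 / \<delta>) / \<epsilon>\<^sup>2 *
     (1 / T powr (2/3) + sqrt dV * ln (max 1 T) / T + dE * ln (max 1 T) / T)"

end

(* One run colours the vertices at random: a vertex stays uncoloured with probability 1 - q and
   otherwise gets one of N colours uniformly. It keeps the edges whose endpoints share a colour and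
   rescales the number of triangles among them by N^2 / q^3, which is unbiased. Two triangles are
   uncorrelated if they are disjoint, and weakly correlated if they share just a vertex, so with
   r = q^2 / N the probability of keeping an edge, the variance over the triangles avoiding the heavy
   vertices and edges is at most T (q / r^2 + 3 Delta_E / r + 3 Delta_V (1 / q - 1)). The heavy
   triangles number at most (eps / 12) T, and by Markov's inequality they rarely contribute more than
   (11 / 12) eps T to the estimate. Hence one run fails with probability at most 1/8, and the median
   of O(log (1 / delta)) runs succeeds with probability 1 - delta. The guess T' is rejected when the
   median is below T' / 2: if T' > 16 T this is likely by Markov's inequality, and otherwise the
   rates chosen for T' are still large enough for accuracy. *)

theory Submission
  imports Defs
begin

section \<open>Heavy elements and heavy triangles\<close>

text \<open>With the heavy prefix as \<open>H\<close>, the ordering disappears from the argument: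
  only the weight budget and the cap on light elements are used later.\<close>

lemma max_light_split:
  assumes "finite X" "b \<ge> 0"
  obtains H where "H \<subseteq> X" "real (\<Sum>x\<in>H. w x) \<le> b"
    "\<And>x. x \<in> X - H \<Longrightarrow> w x \<le> max_light w b X"
proof -
  obtain xs where xs: "descending_order w X xs"
    using descending_order_exists[OF assms(1)] by blast
  define K where "K = {k. k \<le> length xs \<and> real (sum_list (map w (take k xs))) \<le> b}"
  have "finite K" "0 \<in> K" using assms(2) by (auto simp: K_def)
  hence "Max K \<in> K" using Max_in by blast
  hence sum: "real (sum_list (map w (take (Max K) xs))) \<le> b" by (simp add: K_def)
  define H where "H = set (heavy_prefix w b xs)"
  have H: "H = set (take (Max K) xs)" by (simp add: H_def heavy_prefix_def K_def)
  have d: "distinct xs" "set xs = X" using xs by (auto simp: descending_order_def)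
  show ?thesis
  proof
    show "H \<subseteq> X" using H d set_take_subset by fastforce
    have "(\<Sum>x\<in>H. w x) = sum_list (map w (take (Max K) xs))"
      using d by (simp add: H sum_list_distinct_conv_sum_set)
    thus "real (\<Sum>x\<in>H. w x) \<le> b" using sum by simp
  next
    fix x assume "x \<in> X - H"
    thus "w x \<le> max_light w b X"
      using max_light_eq[OF xs, of b] d assms(1)
      by (auto simp: max_light_of_def H_def Let_def intro!: Max_ge)
  qed
qed

lemma finite_triangles: "finite V \<Longrightarrow> finite (triangles V E)"
  by (rule finite_subset[of _ "Pow V"]) (auto simp: triangles_def)

text \<open>\<open>L\<close> consists of the triangles with no heavy vertex and no heavy edge. Every
  other triangle is charged to a heavy vertex or a heavy edge, and each of the two budgets is
  \<open>\<eta> * T\<close>, hence the factor 2. All vertices and edges of a triangle in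
  \<open>L\<close> are light, so the \<Delta> bounds apply to them.\<close>

lemma triangles_split:
  assumes "simple_graph V E" "\<eta> \<ge> 0"
  obtains L where "L \<subseteq> triangles V E"
    "real (card (triangles V E - L)) \<le> 2 * \<eta> * real (num_triangles V E)"
    "\<And>t v. t \<in> L \<Longrightarrow> v \<in> t \<Longrightarrow> card {s\<in>L. v \<in> s} \<le> Delta_V V E \<eta>"
    "\<And>t e. t \<in> L \<Longrightarrow> e \<subseteq> t \<Longrightarrow> card e = 2 \<Longrightarrow> card {s\<in>L. e \<subseteq> s} \<le> Delta_E V E \<eta>"
proof -
  let ?T = "triangles V E" and ?b = "\<eta> * real (num_triangles V E)"
  have fin: "finite V" "finite ?T"
    using assms(1) finite_triangles by (auto simp: simple_graph_def)
  have "E \<subseteq> Pow V" using assms(1) by (auto simp: simple_graph_def vertex_pairs_def)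
  hence finE: "finite E" using fin(1) finite_subset by blast
  have b: "?b \<ge> 0" using assms(2) by simp
  obtain HV where HV: "HV \<subseteq> V" "real (\<Sum>v\<in>HV. vertex_triangles V E v) \<le> ?b"
    "\<And>v. v \<in> V - HV \<Longrightarrow> vertex_triangles V E v \<le> Delta_V V E \<eta>"
    using max_light_split[OF fin(1) b, of "vertex_triangles V E"] unfolding Delta_V_def by blast
  obtain HE where HE: "HE \<subseteq> E" "real (\<Sum>e\<in>HE. edge_triangles V E e) \<le> ?b"
    "\<And>e. e \<in> E - HE \<Longrightarrow> edge_triangles V E e \<le> Delta_E V E \<eta>"
    using max_light_split[OF finE b, of "edge_triangles V E"] unfolding Delta_E_def by blast
  define L where "L = {t \<in> ?T. (\<forall>v\<in>HV. v \<notin> t) \<and> (\<forall>e\<in>HE. \<not> e \<subseteq> t)}"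
  have LT: "L \<subseteq> ?T" by (auto simp: L_def)
  show ?thesis
  proof (rule that[OF LT])
    have fH: "finite HV" "finite HE" using HV(1) HE(1) fin(1) finE finite_subset by blast+
    have "?T - L = (\<Union>v\<in>HV. {t\<in>?T. v \<in> t}) \<union> (\<Union>e\<in>HE. {t\<in>?T. e \<subseteq> t})"
      by (auto simp: L_def)
    hence "card (?T - L) \<le> card (\<Union>v\<in>HV. {t\<in>?T. v \<in> t}) + card (\<Union>e\<in>HE. {t\<in>?T. e \<subseteq> t})"
      using card_Un_le by simp
    also have "\<dots> \<le> (\<Sum>v\<in>HV. vertex_triangles V E v) + (\<Sum>e\<in>HE. edge_triangles V E e)"
      unfolding vertex_triangles_def edge_triangles_def
      using fH by (intro add_mono card_UN_le)
    finally show "real (card (?T - L)) \<le> 2 * \<eta> * real (num_triangles V E)"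
      using HV(2) HE(2) by linarith
  next
    fix t v assume tv: "t \<in> L" "v \<in> t"
    hence "v \<in> V - HV" by (auto simp: L_def triangles_def)
    moreover have "card {s\<in>L. v \<in> s} \<le> vertex_triangles V E v"
      unfolding vertex_triangles_def using LT fin(2) by (intro card_mono) auto
    ultimately show "card {s\<in>L. v \<in> s} \<le> Delta_V V E \<eta>" using HV(3) by fastforce
  next
    fix t e assume te: "t \<in> L" "e \<subseteq> t" "card e = 2"
    hence "e \<in> E - HE" by (auto simp: L_def triangles_def vertex_pairs_def)
    moreover have "card {s\<in>L. e \<subseteq> s} \<le> edge_triangles V E e"
      unfolding edge_triangles_def using LT fin(2) by (intro card_mono) auto
    ultimately show "card {s\<in>L. e \<subseteq> s} \<le> Delta_E V E \<eta>" using HE(3) by fastforce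
  qed
qed

section \<open>Random vertex colourings\<close>

text \<open>Colour \<open>0\<close> marks the vertices that are not sampled.\<close>

definition colour_pmf :: "real \<Rightarrow> nat \<Rightarrow> nat pmf" where
  "colour_pmf q N = bind_pmf (bernoulli_pmf q)
     (\<lambda>b. if b then pmf_of_set {1..N} else return_pmf 0)"

definition colouring_pmf :: "'v set \<Rightarrow> real \<Rightarrow> nat \<Rightarrow> ('v \<Rightarrow> nat) pmf" where
  "colouring_pmf V q N = Pi_pmf V 0 (\<lambda>_. colour_pmf q N)"

text \<open>The colour \<open>0\<close> is excluded, so a set with an unsampled vertex never
  counts.\<close>

definition monochromatic :: "nat \<Rightarrow> ('v \<Rightarrow> nat) \<Rightarrow> 'v set \<Rightarrow> bool" where
  "monochromatic N c A \<longleftrightarrow> (\<exists>j\<in>{1..N}. \<forall>v\<in>A. c v = j)"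

lemma pmf_colour:
  assumes "0 < q" "q \<le> 1" "j \<in> {1..N}"
  shows "pmf (colour_pmf q N) j = q / real N"
  using assms by (auto simp: colour_pmf_def pmf_bind pmf_of_set)

lemma finite_set_colouring_pmf:
  assumes "finite V" "1 \<le> N"
  shows "finite (set_pmf (colouring_pmf V q N))"
proof -
  have "set_pmf (colour_pmf q N) \<subseteq> {0..N}"
    using assms(2) by (auto simp: colour_pmf_def set_pmf_of_set split: if_splits)
  hence "finite (set_pmf (colour_pmf q N))" using finite_subset by blast
  thus ?thesis
    using assms(1) by (simp add: colouring_pmf_def set_Pi_pmf finite_PiE_dflt)
qed

lemma prob_colouring_eq:
  assumes V: "finite V" "U \<subseteq> V" and q: "0 < q" "q \<le> 1" and f: "\<And>v. v \<in> U \<Longrightarrow> f v \<in> {1..N}"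
  shows "measure_pmf.prob (colouring_pmf V q N) {c. \<forall>v\<in>U. c v = f v} = (q / real N) ^ card U"
proof -
  have "{c. \<forall>v\<in>U. c v = f v} = Pi V (\<lambda>v. if v \<in> U then {f v} else UNIV)"
    using V(2) by (auto simp: Pi_def)
  hence "measure_pmf.prob (colouring_pmf V q N) {c. \<forall>v\<in>U. c v = f v}
      = (\<Prod>v\<in>V. measure_pmf.prob (colour_pmf q N) (if v \<in> U then {f v} else UNIV))"
    using V(1) by (simp add: colouring_pmf_def measure_Pi_pmf_Pi)
  also have "\<dots> = (\<Prod>v\<in>V. if v \<in> U then q / real N else 1)"
    using q f by (intro prod.cong) (auto simp: measure_pmf_single pmf_colour)
  also have "\<dots> = (\<Prod>v\<in>U. q / real N)"
    using V by (simp add: prod.If_cases Int_absorb1)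
  finally show ?thesis by simp
qed

text \<open>The \<open>N\<close> possible common colours give disjoint events because
  \<open>A\<close> is nonempty, and each has probability \<open>(q / N) ^ card A\<close> by
  independence of the vertices.\<close>

lemma prob_monochromatic:
  assumes V: "finite V" "A \<subseteq> V" "A \<noteq> {}" and q: "0 < q" "q \<le> 1"
  shows "measure_pmf.prob (colouring_pmf V q N) {c. monochromatic N c A} = real N * (q / real N) ^ card A"
proof -
  have "{c. monochromatic N c A} = (\<Union>j\<in>{1..N}. {c. \<forall>v\<in>A. c v = j})"
    by (auto simp: monochromatic_def)
  hence "measure_pmf.prob (colouring_pmf V q N) {c. monochromatic N c A}
      = (\<Sum>j\<in>{1..N}. measure_pmf.prob (colouring_pmf V q N) {c. \<forall>v\<in>A. c v = j})"
    using V(3) by (simp, intro measure_pmf.finite_measure_finite_Union)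
      (auto simp: disjoint_family_on_def)
  also have "\<dots> = (\<Sum>j\<in>{1..N}. (q / real N) ^ card A)"
    using prob_colouring_eq[OF V(1,2) q] by (intro sum.cong) auto
  finally show ?thesis by simp
qed

text \<open>The product form expresses independence, so disjoint triangles have covariance zero. The
  event is split by the pair of colours of \<open>A\<close> and \<open>B\<close>, which is unique
  since both sets are nonempty.\<close>

lemma prob_monochromatic_disjoint:
  assumes V: "finite V" "A \<subseteq> V" "A \<noteq> {}" "B \<subseteq> V" "B \<noteq> {}" "A \<inter> B = {}"
    and q: "0 < q" "q \<le> 1"
  shows "measure_pmf.prob (colouring_pmf V q N) {c. monochromatic N c A \<and> monochromatic N c B}
    = (real N * (q / real N) ^ card A) * (real N * (q / real N) ^ card B)"
proof -
  let ?f = "\<lambda>(i, j) v. if v \<in> A then i else (j :: nat)"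
  have fin: "finite A" "finite B" using V finite_subset by blast+
  have AB: "(\<forall>v\<in>A \<union> B. c v = ?f (i, j) v) \<longleftrightarrow> (\<forall>v\<in>A. c v = i) \<and> (\<forall>v\<in>B. c v = j)" for c i j
    using V(6) by auto
  have "{c. monochromatic N c A \<and> monochromatic N c B} = (\<Union>p\<in>{1..N}\<times>{1..N}. {c. \<forall>v\<in>A \<union> B. c v = ?f p v})"
    unfolding monochromatic_def set_eq_iff UN_iff Bex_def mem_Sigma_iff split_paired_Ex mem_Collect_eq AB
    by blast
  hence "measure_pmf.prob (colouring_pmf V q N) {c. monochromatic N c A \<and> monochromatic N c B}
      = measure_pmf.prob (colouring_pmf V q N) (\<Union>p\<in>{1..N}\<times>{1..N}. {c. \<forall>v\<in>A \<union> B. c v = ?f p v})"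
    by simp
  also have "\<dots> = (\<Sum>p\<in>{1..N}\<times>{1..N}. measure_pmf.prob (colouring_pmf V q N) {c. \<forall>v\<in>A \<union> B. c v = ?f p v})"
  proof (rule measure_pmf.finite_measure_finite_Union)
    show "disjoint_family_on (\<lambda>p. {c. \<forall>v\<in>A \<union> B. c v = ?f p v}) ({1..N}\<times>{1..N})"
      unfolding disjoint_family_on_def
    proof (intro ballI impI)
      fix p p' :: "nat \<times> nat" assume "p \<noteq> p'"
      obtain a b where ab: "a \<in> A" "b \<in> B" using V by blast
      show "{c. \<forall>v\<in>A \<union> B. c v = ?f p v} \<inter> {c. \<forall>v\<in>A \<union> B. c v = ?f p' v} = {}"
      proof (cases p, cases p')
        fix i j i' j' assume p: "p = (i, j)" "p' = (i', j')"
        show ?thesis unfolding p AB using \<open>p \<noteq> p'\<close> ab p by auto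
      qed
    qed
  qed auto
  also have "\<dots> = (\<Sum>p\<in>{1..N}\<times>{1..N}. (q / real N) ^ card (A \<union> B))"
    using V by (intro sum.cong refl prob_colouring_eq q) auto
  also have "card (A \<union> B) = card A + card B"
    using card_Un_disjoint fin V(6) by blast
  finally show ?thesis by (simp add: power_add algebra_simps)
qed

text \<open>A common vertex forces a common colour. This reduces the joint survival of two
  intersecting triangles to the survival of their union.\<close>

lemma monochromatic_Un_iff:
  assumes "A \<inter> B \<noteq> {}"
  shows "monochromatic N c A \<and> monochromatic N c B \<longleftrightarrow> monochromatic N c (A \<union> B)"
proof -
  obtain x where "x \<in> A" "x \<in> B" using assms by blast
  thus ?thesis by (auto simp: monochromatic_def intro!: bexI[of _ "c x"])
qed

section \<open>The estimator of a single run\<close>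

definition colour_edges :: "'v set \<Rightarrow> nat \<Rightarrow> ('v \<Rightarrow> nat) \<Rightarrow> 'v set set" where
  "colour_edges V N c = {e \<in> vertex_pairs V. monochromatic N c e}"

text \<open>A triangle survives with probability \<open>N (q / N)\<^sup>3 = q\<^sup>3 / N\<^sup>2\<close>.\<close>

definition run_estimate :: "'v set \<Rightarrow> real \<Rightarrow> nat \<Rightarrow> ('v \<Rightarrow> nat) \<Rightarrow> 'v set set \<Rightarrow> real" where
  "run_estimate V q N c F = (real N)\<^sup>2 / q ^ 3 * real (num_triangles V (F \<inter> colour_edges V N c))"

text \<open>Two edges of a triangle share a vertex, so if both are monochromatic they have the same
  colour, and together they cover the triangle.\<close>

lemma triangles_colour_edges:
  "triangles V (E \<inter> colour_edges V N c) = {t \<in> triangles V E. monochromatic N c t}"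
proof -
  have iff: "vertex_pairs t \<subseteq> colour_edges V N c \<longleftrightarrow> monochromatic N c t"
    if t: "t \<subseteq> V" "card t = 3" for t
  proof
    assume *: "vertex_pairs t \<subseteq> colour_edges V N c"
    obtain x y z where xyz: "t = {x, y, z}" "x \<noteq> y" "y \<noteq> z" "x \<noteq> z"
      using t(2) by (metis card_3_iff)
    have "{x, y} \<in> vertex_pairs t" "{y, z} \<in> vertex_pairs t"
      using xyz by (auto simp: vertex_pairs_def)
    hence "monochromatic N c {x, y}" "monochromatic N c {y, z}"
      using * by (auto simp: colour_edges_def)
    hence "monochromatic N c ({x, y} \<union> {y, z})"
      using monochromatic_Un_iff[of "{x, y}" "{y, z}"] by auto
    moreover have "{x, y} \<union> {y, z} = t" using xyz by auto
    ultimately show "monochromatic N c t" by simp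
  next
    assume m: "monochromatic N c t"
    show "vertex_pairs t \<subseteq> colour_edges V N c"
    proof
      fix e assume "e \<in> vertex_pairs t"
      hence e: "e \<subseteq> t" "card e = 2" by (auto simp: vertex_pairs_def)
      moreover have "monochromatic N c e" using m e(1) unfolding monochromatic_def by (meson subsetD)
      ultimately show "e \<in> colour_edges V N c" using t(1) by (auto simp: colour_edges_def vertex_pairs_def)
    qed
  qed
  show ?thesis
    by (simp add: triangles_def iff set_eq_iff cong: conj_cong)
qed

text \<open>The contribution of one triangle to the estimate, scaled to have expectation 1.\<close>

definition hit :: "real \<Rightarrow> nat \<Rightarrow> 'v set \<Rightarrow> ('v \<Rightarrow> nat) \<Rightarrow> real" where
  "hit q N t c = (real N)\<^sup>2 / q ^ 3 * indicator {c. monochromatic N c t} c"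

lemma run_estimate_eq:
  assumes "finite V"
  shows "run_estimate V q N c E = (\<Sum>t\<in>triangles V E. hit q N t c)"
proof -
  have "real (num_triangles V (E \<inter> colour_edges V N c))
      = (\<Sum>t\<in>triangles V E. indicator {c. monochromatic N c t} c)"
    using finite_triangles[OF assms]
    unfolding num_triangles_def triangles_colour_edges indicator_def by (simp add: Int_def)
  thus ?thesis by (simp add: run_estimate_def hit_def sum_distrib_left)
qed

section \<open>First and second moments of the estimator\<close>

context
  fixes V :: "'v set" and q :: real and N :: nat
  assumes V: "finite V" and q: "0 < q" "q \<le> 1" and N: "1 \<le> N"
begin

lemma integrable_colouring: "integrable (measure_pmf (colouring_pmf V q N)) (f :: _ \<Rightarrow> real)"
  by (intro integrable_measure_pmf_finite finite_set_colouring_pmf V N)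

lemma expectation_hit:
  assumes "t \<subseteq> V" "card t = 3"
  shows "measure_pmf.expectation (colouring_pmf V q N) (hit q N t) = 1"
proof -
  have "t \<noteq> {}" using assms by auto
  thus ?thesis
    using prob_monochromatic[OF V assms(1) _ q] q N assms
    by (simp add: hit_def[abs_def] field_simps power2_eq_square power3_eq_cube)
qed

text \<open>If \<open>t\<close> and \<open>s\<close> meet in \<open>i > 0\<close> vertices, their
  union has \<open>6 - i\<close> vertices and both survive with probability
  \<open>N * (q / N) ^ (6 - i)\<close>. After scaling, this is \<open>N^2 / q^3\<close>,
  \<open>N / q^2\<close> and \<open>1 / q\<close> for \<open>i = 3, 2, 1\<close>. The subtracted 1
  is retained only for \<open>i = 1\<close>, so that this term vanishes at
  \<open>q = 1\<close>.\<close>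

lemma covariance_hit_le:
  assumes t: "t \<subseteq> V" "card t = 3" and s: "s \<subseteq> V" "card s = 3"
  shows "measure_pmf.expectation (colouring_pmf V q N) (\<lambda>c. hit q N t c * hit q N s c) - 1
    \<le> of_bool (s = t) * ((real N)\<^sup>2 / q ^ 3) + of_bool (card (t \<inter> s) = 2) * (real N / q\<^sup>2)
      + of_bool (card (t \<inter> s) = 1) * (1 / q - 1)"
proof -
  have fin: "finite t" "finite s" and ne: "t \<noteq> {}" "s \<noteq> {}"
    using V t s finite_subset by auto
  let ?P = "measure_pmf.prob (colouring_pmf V q N) {c. monochromatic N c t \<and> monochromatic N c s}"
  have "hit q N t c * hit q N s c
      = ((real N)\<^sup>2 / q ^ 3)\<^sup>2 * indicator {c. monochromatic N c t \<and> monochromatic N c s} c" for c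
    by (simp add: hit_def indicator_def power2_eq_square)
  hence E: "measure_pmf.expectation (colouring_pmf V q N) (\<lambda>c. hit q N t c * hit q N s c)
      = ((real N)\<^sup>2 / q ^ 3)\<^sup>2 * ?P" by simp
  have un: "card (t \<union> s) = 6 - card (t \<inter> s)"
    using card_Un_Int[OF fin] t s by simp
  have le: "card (t \<inter> s) \<le> 3" using card_mono[OF fin(1), of "t \<inter> s"] t by simp
  have P: "?P = real N * (q / real N) ^ (6 - card (t \<inter> s))" if "t \<inter> s \<noteq> {}"
    using prob_monochromatic[OF V, of "t \<union> s" q N] monochromatic_Un_iff[OF that] t s ne q un
    by simp
  have N0: "real N > 0" using N by simp
  consider "card (t \<inter> s) = 0" | "card (t \<inter> s) = 1" | "card (t \<inter> s) = 2" | "card (t \<inter> s) = 3"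
    using le by linarith
  thus ?thesis
  proof cases
    case 1
    hence "t \<inter> s = {}" using fin by simp
    hence "?P = (real N * (q / real N) ^ 3) * (real N * (q / real N) ^ 3)"
      using prob_monochromatic_disjoint[OF V t(1) ne(1) s(1) ne(2) _ q] t s by simp
    thus ?thesis unfolding E using 1 q N0 by (simp add: field_simps eval_nat_numeral)
  next
    case 2
    hence "t \<inter> s \<noteq> {}" by auto
    thus ?thesis unfolding E using P 2 q N0 by (auto simp: field_simps eval_nat_numeral)
  next
    case 3
    hence "t \<inter> s \<noteq> {}" by auto
    thus ?thesis unfolding E using P 3 q N0 by (auto simp: field_simps eval_nat_numeral)
  next
    case 4
    have "t \<inter> s = t" using card_subset_eq[OF fin(1), of "t \<inter> s"] 4 t by auto
    moreover have "t \<inter> s = s" using card_subset_eq[OF fin(2), of "t \<inter> s"] 4 s by auto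
    ultimately have ts: "s = t" by blast
    have "t \<inter> s \<noteq> {}" using 4 by auto
    thus ?thesis unfolding E using P 4 q N0 ts by (auto simp: field_simps eval_nat_numeral)
  qed
qed

lemma expectation_sum_hit:
  assumes "finite L" "\<And>t. t \<in> L \<Longrightarrow> t \<subseteq> V \<and> card t = 3"
  shows "measure_pmf.expectation (colouring_pmf V q N) (\<lambda>c. \<Sum>t\<in>L. hit q N t c) = real (card L)"
proof -
  have "measure_pmf.expectation (colouring_pmf V q N) (\<lambda>c. \<Sum>t\<in>L. hit q N t c)
      = (\<Sum>t\<in>L. measure_pmf.expectation (colouring_pmf V q N) (hit q N t))"
    by (intro Bochner_Integration.integral_sum integrable_colouring)
  also have "\<dots> = (\<Sum>t\<in>L. 1)" using assms expectation_hit by (intro sum.cong) auto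
  finally show ?thesis by simp
qed

text \<open>The second moment is a double sum of covariances. For fixed \<open>t\<close>, the
  triangles sharing an edge with it are counted through its three edges, and those sharing just a
  vertex through its three vertices.\<close>

lemma second_moment_sum_hit_le:
  assumes L: "finite L" "\<And>t. t \<in> L \<Longrightarrow> t \<subseteq> V \<and> card t = 3"
    and DV: "\<And>t v. t \<in> L \<Longrightarrow> v \<in> t \<Longrightarrow> card {s\<in>L. v \<in> s} \<le> DV"
    and DE: "\<And>t e. t \<in> L \<Longrightarrow> e \<subseteq> t \<Longrightarrow> card e = 2 \<Longrightarrow> card {s\<in>L. e \<subseteq> s} \<le> DE"
  shows "measure_pmf.expectation (colouring_pmf V q N) (\<lambda>c. ((\<Sum>t\<in>L. hit q N t c) - real (card L))\<^sup>2)
    \<le> real (card L) * ((real N)\<^sup>2 / q ^ 3 + 3 * real DE * (real N / q\<^sup>2) + 3 * real DV * (1 / q - 1))"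
proof -
  let ?E = "measure_pmf.expectation (colouring_pmf V q N)"
  let ?W = "(real N)\<^sup>2 / q ^ 3" and ?e = "real N / q\<^sup>2" and ?v = "1 / q - 1"
  have sq: "((\<Sum>t\<in>L. hit q N t c) - real (card L))\<^sup>2
      = (\<Sum>t\<in>L. \<Sum>s\<in>L. hit q N t c * hit q N s c - hit q N t c - hit q N s c + 1)" for c
  proof -
    have "(\<Sum>t\<in>L. hit q N t c) - real (card L) = (\<Sum>t\<in>L. hit q N t c - 1)"
      by (simp add: sum_subtractf)
    thus ?thesis by (simp add: power2_eq_square sum_product algebra_simps)
  qed
  have "?E (\<lambda>c. ((\<Sum>t\<in>L. hit q N t c) - real (card L))\<^sup>2)
      = (\<Sum>t\<in>L. \<Sum>s\<in>L. ?E (\<lambda>c. hit q N t c * hit q N s c - hit q N t c - hit q N s c + 1))"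
    unfolding sq by (simp add: Bochner_Integration.integral_sum integrable_colouring)
  \<comment> \<open>Every \<open>hit\<close> has expectation 1, so the three remaining terms
    contribute \<open>-1 - 1 + 1\<close>.\<close>
  also have "\<dots> = (\<Sum>t\<in>L. \<Sum>s\<in>L. ?E (\<lambda>c. hit q N t c * hit q N s c) - 1)"
  proof (intro sum.cong refl)
    fix t s assume "t \<in> L" "s \<in> L"
    thus "?E (\<lambda>c. hit q N t c * hit q N s c - hit q N t c - hit q N s c + 1)
        = ?E (\<lambda>c. hit q N t c * hit q N s c) - 1"
      using expectation_hit L(2) by (simp add: integrable_colouring)
  qed
  also have "\<dots> \<le> (\<Sum>t\<in>L. ?W + 3 * real DE * ?e + 3 * real DV * ?v)"
  proof (rule sum_mono)
    fix t assume t: "t \<in> L"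
    have t3: "t \<subseteq> V" "card t = 3" "finite t" using L(2)[OF t] V finite_subset by auto
    have nn: "?e \<ge> 0" "?v \<ge> 0" using q by (auto simp: field_simps)
    have "{s\<in>L. card (t \<inter> s) = 2} \<subseteq> (\<Union>e\<in>{e. e \<subseteq> t \<and> card e = 2}. {s\<in>L. e \<subseteq> s})"
    proof
      fix s assume "s \<in> {s\<in>L. card (t \<inter> s) = 2}"
      thus "s \<in> (\<Union>e\<in>{e. e \<subseteq> t \<and> card e = 2}. {s\<in>L. e \<subseteq> s})"
        by (intro UN_I[of "t \<inter> s"]) auto
    qed
    hence "card {s\<in>L. card (t \<inter> s) = 2} \<le> card (\<Union>e\<in>{e. e \<subseteq> t \<and> card e = 2}. {s\<in>L. e \<subseteq> s})"
      using L(1) t3 by (intro card_mono) auto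
    also have "\<dots> \<le> (\<Sum>e\<in>{e. e \<subseteq> t \<and> card e = 2}. card {s\<in>L. e \<subseteq> s})"
      using t3 by (intro card_UN_le) auto
    also have "\<dots> \<le> (\<Sum>e\<in>{e. e \<subseteq> t \<and> card e = 2}. DE)"
      using DE t by (intro sum_mono) auto
    also have "\<dots> = 3 * DE"
      using n_subsets[OF t3(3), of 2] t3(2) by (simp add: numeral_3_eq_3 numeral_2_eq_2)
    finally have c2: "real (card {s\<in>L. card (t \<inter> s) = 2}) \<le> 3 * real DE" by linarith
    have "{s\<in>L. card (t \<inter> s) = 1} \<subseteq> (\<Union>v\<in>t. {s\<in>L. v \<in> s})"
      by (auto simp: card_Suc_eq)
    hence "card {s\<in>L. card (t \<inter> s) = 1} \<le> card (\<Union>v\<in>t. {s\<in>L. v \<in> s})"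
      using L(1) t3 by (intro card_mono) auto
    also have "\<dots> \<le> (\<Sum>v\<in>t. card {s\<in>L. v \<in> s})"
      using t3 by (intro card_UN_le) auto
    also have "\<dots> \<le> (\<Sum>v\<in>t. DV)"
      using DV t by (intro sum_mono) auto
    finally have c1: "real (card {s\<in>L. card (t \<inter> s) = 1}) \<le> 3 * real DV" using t3 by simp
    have count: "(\<Sum>s\<in>L. of_bool (P s) * a) = real (card {s\<in>L. P s}) * a" for P and a :: real
      using L(1) by (simp add: Int_def flip: sum_distrib_right)
    have one: "{s\<in>L. s = t} = {t}" using t by auto
    have "(\<Sum>s\<in>L. ?E (\<lambda>c. hit q N t c * hit q N s c) - 1)
      \<le> (\<Sum>s\<in>L. of_bool (s = t) * ?W + of_bool (card (t \<inter> s) = 2) * ?e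
          + of_bool (card (t \<inter> s) = 1) * ?v)"
      using L(2) t3 by (intro sum_mono covariance_hit_le) auto
    also have "\<dots> = ?W + real (card {s\<in>L. card (t \<inter> s) = 2}) * ?e
        + real (card {s\<in>L. card (t \<inter> s) = 1}) * ?v"
      unfolding sum.distrib count one by simp
    also have "\<dots> \<le> ?W + 3 * real DE * ?e + 3 * real DV * ?v"
      using mult_right_mono[OF c2 nn(1)] mult_right_mono[OF c1 nn(2)] by linarith
    finally show "(\<Sum>s\<in>L. ?E (\<lambda>c. hit q N t c * hit q N s c) - 1)
      \<le> ?W + 3 * real DE * ?e + 3 * real DV * ?v" .
  qed
  finally show ?thesis by simp
qed

end

section \<open>Error probability of a single run\<close>

lemma markov_pmf:
  fixes f :: "'a \<Rightarrow> real"
  assumes "finite (set_pmf M)" "\<And>x. 0 \<le> f x" "0 < a"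
  shows "measure_pmf.prob M {x. a \<le> f x} \<le> measure_pmf.expectation M f / a"
  using integral_Markov_inequality_measure[of "measure_pmf M" f UNIV a] assms
  by (simp add: integrable_measure_pmf_finite)

lemma sum_hit_nonneg: "0 < q \<Longrightarrow> 0 \<le> (\<Sum>t\<in>L. hit q N t c)"
  by (intro sum_nonneg) (simp add: hit_def)

context
  fixes V :: "'v set" and E :: "'v set set" and q :: real and N :: nat
  assumes graph: "simple_graph V E" and q: "0 < q" "q \<le> 1" and N: "1 \<le> N"
begin

lemma run_estimate_markov:
  assumes "0 < a"
  shows "measure_pmf.prob (colouring_pmf V q N) {c. a \<le> run_estimate V q N c E}
    \<le> real (num_triangles V E) / a"
proof -
  have V: "finite V" using graph by (simp add: simple_graph_def)
  have "measure_pmf.expectation (colouring_pmf V q N) (\<lambda>c. \<Sum>t\<in>triangles V E. hit q N t c)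
      = real (num_triangles V E)"
    unfolding num_triangles_def
    by (rule expectation_sum_hit[OF V q N finite_triangles[OF V]]) (auto simp: triangles_def)
  moreover have "measure_pmf.prob (colouring_pmf V q N) {c. a \<le> (\<Sum>t\<in>triangles V E. hit q N t c)}
      \<le> measure_pmf.expectation (colouring_pmf V q N) (\<lambda>c. \<Sum>t\<in>triangles V E. hit q N t c) / a"
    by (intro markov_pmf finite_set_colouring_pmf V N sum_hit_nonneg q assms)
  ultimately show ?thesis by (simp add: run_estimate_eq[OF V])
qed

text \<open>The interval is asymmetric because heavy triangles can only raise the estimate. Below,
  \<open>\<epsilon> / 12\<close> is lost to the deviation of the light part and
  \<open>\<epsilon> / 12\<close> to heavy triangles that may contribute nothing; above, the losses
  are \<open>\<epsilon> / 12\<close> and \<open>11 / 12 * \<epsilon>\<close>. The sharp lower end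
  keeps the estimate above \<open>T / 2\<close> for every \<open>\<epsilon> < 1\<close>.\<close>

lemma run_estimate_accurate:
  assumes \<epsilon>: "0 < \<epsilon>" "\<epsilon> < 1" and T: "num_triangles V E > 0"
    and var: "(real N)\<^sup>2 / q ^ 3 + 3 * real (Delta_E V E (\<epsilon> / 24)) * (real N / q\<^sup>2)
      + 3 * real (Delta_V V E (\<epsilon> / 24)) * (1 / q - 1) \<le> \<epsilon>\<^sup>2 * real (num_triangles V E) / 5760"
  shows "measure_pmf.prob (colouring_pmf V q N)
    {c. run_estimate V q N c E \<notin> {(1 - \<epsilon> / 6) * real (num_triangles V E) .. (1 + \<epsilon>) * real (num_triangles V E)}}
    \<le> 1 / 8"
proof -
  let ?M = "colouring_pmf V q N" and ?T = "real (num_triangles V E)"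
  have V: "finite V" using graph by (simp add: simple_graph_def)
  note finM = finite_set_colouring_pmf[OF V N, of q]
  have "\<epsilon> / 24 \<ge> 0" using \<epsilon> by simp
  then obtain L where L: "L \<subseteq> triangles V E"
    "real (card (triangles V E - L)) \<le> 2 * (\<epsilon> / 24) * ?T"
    "\<And>t v. t \<in> L \<Longrightarrow> v \<in> t \<Longrightarrow> card {s\<in>L. v \<in> s} \<le> Delta_V V E (\<epsilon> / 24)"
    "\<And>t e. t \<in> L \<Longrightarrow> e \<subseteq> t \<Longrightarrow> card e = 2 \<Longrightarrow> card {s\<in>L. e \<subseteq> s} \<le> Delta_E V E (\<epsilon> / 24)"
    using triangles_split[OF graph] by blast
  define H where "H = triangles V E - L"
  have fin: "finite L" "finite H" "L \<inter> H = {}" "L \<union> H = triangles V E"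
    using finite_triangles[OF V, of E] L(1) finite_subset by (auto simp: H_def)
  have three: "t \<subseteq> V \<and> card t = 3" if "t \<in> L \<union> H" for t
    using that fin(4) by (auto simp: triangles_def)
  have cardT: "real (card L) + real (card H) = ?T"
    using card_Un_disjoint[OF fin(1-3)] fin(4) by (simp add: num_triangles_def)
  define XL where "XL c = (\<Sum>t\<in>L. hit q N t c)" for c
  define XH where "XH c = (\<Sum>t\<in>H. hit q N t c)" for c
  have X: "run_estimate V q N c E = XL c + XH c" for c
    using sum.union_disjoint[OF fin(1-3)] fin(4) by (simp add: run_estimate_eq[OF V] XL_def XH_def)
  have XH0: "XH c \<ge> 0" for c
    using sum_hit_nonneg[OF q(1)] by (simp add: XH_def)
  have T0: "?T > 0" using T by simp
  have cardH: "real (card H) \<le> \<epsilon> / 12 * ?T" using L(2) by (simp add: H_def)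
  have "measure_pmf.expectation ?M (\<lambda>c. (XL c - real (card L))\<^sup>2)
      \<le> real (card L) * ((real N)\<^sup>2 / q ^ 3 + 3 * real (Delta_E V E (\<epsilon> / 24)) * (real N / q\<^sup>2)
        + 3 * real (Delta_V V E (\<epsilon> / 24)) * (1 / q - 1))"
    unfolding XL_def by (rule second_moment_sum_hit_le[OF V q N fin(1)]) (use three L in auto)
  also have "\<dots> \<le> real (card L) * (\<epsilon>\<^sup>2 * ?T / 5760)"
    using var by (intro mult_left_mono) auto
  also have "\<dots> \<le> ?T * (\<epsilon>\<^sup>2 * ?T / 5760)"
    using cardT by (intro mult_right_mono) auto
  \<comment> \<open>Here \<open>5760 = 12^2 * 40\<close>, so that Chebyshev's inequality at
    deviation \<open>\<epsilon> / 12 * T\<close> gives failure probability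
    \<open>1 / 40\<close>.\<close>
  also have "\<dots> = (\<epsilon> / 12 * ?T)\<^sup>2 / 40" by (simp add: power2_eq_square)
  finally have second: "measure_pmf.expectation ?M (\<lambda>c. (XL c - real (card L))\<^sup>2) \<le> (\<epsilon> / 12 * ?T)\<^sup>2 / 40" .
  have "measure_pmf.prob ?M {c. (\<epsilon> / 12 * ?T)\<^sup>2 \<le> (XL c - real (card L))\<^sup>2}
      \<le> measure_pmf.expectation ?M (\<lambda>c. (XL c - real (card L))\<^sup>2) / (\<epsilon> / 12 * ?T)\<^sup>2"
    using \<epsilon> T0 by (intro markov_pmf finM) auto
  also have "\<dots> \<le> (\<epsilon> / 12 * ?T)\<^sup>2 / 40 / (\<epsilon> / 12 * ?T)\<^sup>2"
    using second by (intro divide_right_mono) auto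
  also have "\<dots> = 1 / 40" using \<epsilon> T0 by simp
  finally have light: "measure_pmf.prob ?M {c. (\<epsilon> / 12 * ?T)\<^sup>2 \<le> (XL c - real (card L))\<^sup>2} \<le> 1 / 40" .
  have "measure_pmf.expectation ?M XH = real (card H)"
    unfolding XH_def[abs_def] by (rule expectation_sum_hit[OF V q N fin(2)]) (use three in auto)
  hence "measure_pmf.prob ?M {c. 11 / 12 * \<epsilon> * ?T \<le> XH c} \<le> real (card H) / (11 / 12 * \<epsilon> * ?T)"
    using markov_pmf[OF finM, of XH "11 / 12 * \<epsilon> * ?T"] XH0 \<epsilon> T0 by simp
  also have "\<dots> \<le> (\<epsilon> / 12 * ?T) / (11 / 12 * \<epsilon> * ?T)"
    using cardH \<epsilon> T0 by (intro divide_right_mono) auto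
  also have "\<dots> = 1 / 11" using \<epsilon> T0 by simp
  finally have heavy: "measure_pmf.prob ?M {c. 11 / 12 * \<epsilon> * ?T \<le> XH c} \<le> 1 / 11" .
  have "{c. run_estimate V q N c E \<notin> {(1 - \<epsilon> / 6) * ?T .. (1 + \<epsilon>) * ?T}}
      \<subseteq> {c. (\<epsilon> / 12 * ?T)\<^sup>2 \<le> (XL c - real (card L))\<^sup>2} \<union> {c. 11 / 12 * \<epsilon> * ?T \<le> XH c}"
  proof
    fix c assume c: "c \<in> {c. run_estimate V q N c E \<notin> {(1 - \<epsilon> / 6) * ?T .. (1 + \<epsilon>) * ?T}}"
    show "c \<in> {c. (\<epsilon> / 12 * ?T)\<^sup>2 \<le> (XL c - real (card L))\<^sup>2} \<union> {c. 11 / 12 * \<epsilon> * ?T \<le> XH c}"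
    proof (rule ccontr)
      assume "\<not> ?thesis"
      hence a: "(XL c - real (card L))\<^sup>2 < (\<epsilon> / 12 * ?T)\<^sup>2" and b: "XH c < 11 / 12 * \<epsilon> * ?T" by auto
      have "\<bar>XL c - real (card L)\<bar> < \<epsilon> / 12 * ?T"
        using a \<epsilon> T0 by (metis abs_le_square_iff abs_of_nonneg linorder_not_le mult_nonneg_nonneg
          divide_nonneg_nonneg less_imp_le zero_le_numeral)
      moreover define y where "y = \<epsilon> * ?T"
      ultimately have "\<bar>XL c - real (card L)\<bar> < y / 12" by simp
      moreover have "XH c < 11 / 12 * y" "real (card H) \<le> y / 12"
        using b cardH by (simp_all add: y_def)
      ultimately have "?T - y / 6 \<le> XL c + XH c" "XL c + XH c \<le> ?T + y"
        using XH0[of c] cardT by linarith+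
      thus False using c by (simp add: X y_def algebra_simps)
    qed
  qed
  hence "measure_pmf.prob ?M {c. run_estimate V q N c E \<notin> {(1 - \<epsilon> / 6) * ?T .. (1 + \<epsilon>) * ?T}}
      \<le> measure_pmf.prob ?M ({c. (\<epsilon> / 12 * ?T)\<^sup>2 \<le> (XL c - real (card L))\<^sup>2} \<union> {c. 11 / 12 * \<epsilon> * ?T \<le> XH c})"
    by (intro measure_pmf.finite_measure_mono) auto
  \<comment> \<open>The sum is \<open>51 / 440\<close>, which is below \<open>1 / 8\<close>.\<close>
  also have "\<dots> \<le> 1 / 40 + 1 / 11"
    using light heavy by (intro order_trans[OF measure_Un_le] add_mono) auto
  finally show ?thesis by simp
qed

end

text \<open>With \<open>q = 1\<close> and a single colour, every vertex receives colour 1 almost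
  surely and the whole graph is kept. This covers saturated sampling rates.\<close>

lemma run_estimate_exact:
  assumes "simple_graph V E"
  shows "measure_pmf.prob (colouring_pmf V 1 1) {c. run_estimate V 1 1 c E \<noteq> real (num_triangles V E)} = 0"
\<comment> \<open>\<open>prob_monochromatic\<close>, applied to \<open>V\<close> itself, requires a
  nonempty set.\<close>
proof (cases "V = {}")
  case True
  hence "triangles V F = {}" for F by (auto simp: triangles_def)
  thus ?thesis by (simp add: run_estimate_def num_triangles_def)
next
  case False
  have V: "finite V" using assms by (simp add: simple_graph_def)
  let ?M = "colouring_pmf V 1 1"
  have "measure_pmf.prob ?M {c. monochromatic 1 c V} = 1"
    using prob_monochromatic[OF V order_refl False, of 1 1] by simp
  hence "measure_pmf.prob ?M (- {c. monochromatic 1 c V}) = 0"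
    using measure_pmf.prob_compl[of "{c. monochromatic 1 c V}" ?M] by (simp add: Compl_eq_Diff_UNIV)
  moreover have "run_estimate V 1 1 c E = real (num_triangles V E)" if "monochromatic 1 c V" for c
  proof -
    have "hit 1 1 t c = 1" if "t \<in> triangles V E" for t
      using that \<open>monochromatic 1 c V\<close> by (auto simp: hit_def triangles_def monochromatic_def indicator_def)
    thus ?thesis by (simp add: run_estimate_eq[OF V] num_triangles_def)
  qed
  hence "{c. run_estimate V 1 1 c E \<noteq> real (num_triangles V E)} \<subseteq> - {c. monochromatic 1 c V}" by auto
  ultimately show ?thesis
    using measure_pmf.finite_measure_mono[of _ "- {c. monochromatic 1 c V}" ?M]
    by (metis UNIV_I measure_le_0_iff sets_measure_pmf)
qed

section \<open>Medians of independent runs\<close>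

text \<open>The largest value that is reached or exceeded by at least half of the entries.\<close>

definition upper_median :: "nat \<Rightarrow> (nat \<Rightarrow> real) \<Rightarrow> real" where
  "upper_median k f = Max {x \<in> f ` {..<k}. k \<le> 2 * card {i. i < k \<and> x \<le> f i}}"

text \<open>The smallest value in \<open>I\<close> is reached by a majority, so it is a lower bound
  for the median. A median above the largest value in \<open>I\<close> would leave at least half of
  the indices outside \<open>I\<close>. Convexity of \<open>I\<close> then suffices, which admits
  closed intervals as well as half-lines.\<close>

lemma upper_median_mem:
  assumes maj: "k < 2 * card {i. i < k \<and> f i \<in> I}"
    and conv: "\<And>a b x. a \<in> I \<Longrightarrow> b \<in> I \<Longrightarrow> a \<le> x \<Longrightarrow> x \<le> b \<Longrightarrow> x \<in> I"
  shows "upper_median k f \<in> I"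
proof -
  let ?J = "{i. i < k \<and> f i \<in> I}" and ?Q = "{x \<in> f ` {..<k}. k \<le> 2 * card {i. i < k \<and> x \<le> f i}}"
  have "finite ?J" by simp
  moreover have "?J \<noteq> {}" using maj by (metis card.empty mult_0_right not_less_zero)
  ultimately have fJ: "finite (f ` ?J)" "f ` ?J \<noteq> {}" by auto
  have lo: "Min (f ` ?J) \<in> I" and hi: "Max (f ` ?J) \<in> I"
    using Min_in[OF fJ] Max_in[OF fJ] by auto
  have "card ?J \<le> card {i. i < k \<and> Min (f ` ?J) \<le> f i}"
    using fJ by (intro card_mono) (auto intro: Min_le)
  hence mem: "Min (f ` ?J) \<in> ?Q"
    using Min_in[OF fJ] maj by auto
  have fQ: "finite ?Q" by simp
  have 1: "Min (f ` ?J) \<le> upper_median k f"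
    unfolding upper_median_def using mem fQ by (rule Max_ge[rotated])
  have "upper_median k f \<in> ?Q"
    unfolding upper_median_def using mem fQ by (intro Max_in) auto
  hence k: "k \<le> 2 * card {i. i < k \<and> upper_median k f \<le> f i}" by simp
  have 2: "upper_median k f \<le> Max (f ` ?J)"
  proof (rule ccontr)
    assume "\<not> ?thesis"
    hence gt: "Max (f ` ?J) < upper_median k f" by simp
    have disj: "?J \<inter> {i. i < k \<and> upper_median k f \<le> f i} = {}"
      using gt Max_ge[OF fJ(1)] by fastforce
    have "card ?J + card {i. i < k \<and> upper_median k f \<le> f i}
        = card (?J \<union> {i. i < k \<and> upper_median k f \<le> f i})"
      using disj by (intro card_Un_disjoint[symmetric]) auto
    also have "\<dots> \<le> card {..<k}" by (intro card_mono) auto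
    finally show False using k maj by simp
  qed
  show ?thesis by (rule conv[OF lo hi 1 2])
qed

text \<open>Union bound over the at most \<open>4 ^ l\<close> index sets of size at least
  \<open>l\<close>, on each of which all runs are bad with probability at most
  \<open>(1 / 8) ^ l\<close>. This is why a single run has to fail with probability at most
  \<open>1 / 8\<close>.\<close>

lemma prob_half_bad_le:
  assumes "measure_pmf.prob P B \<le> 1 / 8"
  shows "measure_pmf.prob (Pi_pmf {..<2 * l} d (\<lambda>_. P)) {\<omega>. l \<le> card {i. i < 2 * l \<and> \<omega> i \<in> B}}
    \<le> (1 / 2) ^ l"
proof -
  let ?M = "Pi_pmf {..<2 * l} d (\<lambda>_. P)" and ?F = "{J. J \<subseteq> {..<2 * l} \<and> l \<le> card J}"
  have finF: "finite ?F" by (rule finite_subset[of _ "Pow {..<2 * l}"]) auto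
  have "card ?F \<le> card (Pow {..<2 * l})" by (intro card_mono) auto
  also have "\<dots> = 4 ^ l" by (simp add: card_Pow power_mult)
  finally have cardF: "real (card ?F) \<le> 4 ^ l"
    by (metis of_nat_le_iff of_nat_numeral of_nat_power)
  have one: "measure_pmf.prob ?M {\<omega>. \<forall>i\<in>J. \<omega> i \<in> B} \<le> (1 / 8) ^ l" if J: "J \<in> ?F" for J
  proof -
    have "{\<omega>. \<forall>i\<in>J. \<omega> i \<in> B} = Pi {..<2 * l} (\<lambda>i. if i \<in> J then B else UNIV)"
      using J by (auto simp: Pi_def)
    hence "measure_pmf.prob ?M {\<omega>. \<forall>i\<in>J. \<omega> i \<in> B}
        = (\<Prod>i<2 * l. measure_pmf.prob P (if i \<in> J then B else UNIV))"
      by (simp add: measure_Pi_pmf_Pi)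
    also have "\<dots> = (\<Prod>i<2 * l. if i \<in> J then measure_pmf.prob P B else 1)"
      by (intro prod.cong) auto
    also have "\<dots> = measure_pmf.prob P B ^ card J"
      using J by (simp add: prod.If_cases Int_absorb1)
    also have "\<dots> \<le> (1 / 8) ^ card J"
      using assms by (intro power_mono) auto
    also have "\<dots> \<le> (1 / 8) ^ l"
      using J by (intro power_decreasing) auto
    finally show ?thesis .
  qed
  have "{\<omega>. l \<le> card {i. i < 2 * l \<and> \<omega> i \<in> B}} \<subseteq> (\<Union>J\<in>?F. {\<omega>. \<forall>i\<in>J. \<omega> i \<in> B})"
  proof
    fix \<omega> assume "\<omega> \<in> {\<omega>. l \<le> card {i. i < 2 * l \<and> \<omega> i \<in> B}}"
    thus "\<omega> \<in> (\<Union>J\<in>?F. {\<omega>. \<forall>i\<in>J. \<omega> i \<in> B})"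
      by (intro UN_I[of "{i. i < 2 * l \<and> \<omega> i \<in> B}"]) auto
  qed
  hence "measure_pmf.prob ?M {\<omega>. l \<le> card {i. i < 2 * l \<and> \<omega> i \<in> B}}
      \<le> measure_pmf.prob ?M (\<Union>J\<in>?F. {\<omega>. \<forall>i\<in>J. \<omega> i \<in> B})"
    by (intro measure_pmf.finite_measure_mono) auto
  also have "\<dots> \<le> (\<Sum>J\<in>?F. measure_pmf.prob ?M {\<omega>. \<forall>i\<in>J. \<omega> i \<in> B})"
    using finF by (intro measure_pmf.finite_measure_subadditive_finite) auto
  also have "\<dots> \<le> (\<Sum>J\<in>?F. (1 / 8) ^ l)" by (intro sum_mono one)
  also have "\<dots> \<le> 4 ^ l * (1 / 8) ^ l" using cardF by (simp add: mult_right_mono)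
  also have "\<dots> = (1 / 2) ^ l" by (simp flip: power_mult_distrib)
  finally show ?thesis .
qed

text \<open>Intersecting with the supports makes both factors countable, as
  \<open>measure_pmf_prob_product\<close> requires.\<close>

lemma prob_pair_pmf:
  "measure_pmf.prob (pair_pmf M N) (A \<times> B) = measure_pmf.prob M A * measure_pmf.prob N B"
proof -
  have "measure_pmf.prob (pair_pmf M N) (A \<times> B)
      = measure_pmf.prob (pair_pmf M N) ((A \<inter> set_pmf M) \<times> (B \<inter> set_pmf N))"
    using measure_Int_set_pmf[of "pair_pmf M N" "A \<times> B"] by (simp add: Times_Int_Times)
  also have "\<dots> = measure_pmf.prob M (A \<inter> set_pmf M) * measure_pmf.prob N (B \<inter> set_pmf N)"
    by (rule measure_pmf_prob_product) auto
  finally show ?thesis by (simp add: measure_Int_set_pmf)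
qed

section \<open>The sampler\<close>

text \<open>The coin \<open>b\<close> thins the sample when \<open>\<delta>\<close> is close to \<open>1\<close>, where the allowed number of samples
  tends to \<open>0\<close>.\<close>

definition median_sampler :: "'v set \<Rightarrow> real \<Rightarrow> nat \<Rightarrow> nat \<Rightarrow> real \<Rightarrow> real \<Rightarrow> 'v sampler" where
  "median_sampler V q N l \<beta> \<tau> = map_pmf
     (\<lambda>(b, \<omega>). if b
        then (\<Union>i<2 * l. colour_edges V N (\<omega> i),
              \<lambda>F. let M = upper_median (2 * l) (\<lambda>i. run_estimate V q N (\<omega> i) F)
                  in if M < \<tau> then Guess_Too_Large else Estimate M)
        else ({}, \<lambda>_. Guess_Too_Large))
     (pair_pmf (bernoulli_pmf \<beta>) (Pi_pmf {..<2 * l} (\<lambda>_. 0) (\<lambda>_. colouring_pmf V q N)))"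

lemma sampler_on_median_sampler: "sampler_on V (median_sampler V q N l \<beta> \<tau>)"
  by (auto simp: sampler_on_def median_sampler_def colour_edges_def split: if_splits)

lemma set_kept_edges: "edge_stream E es \<Longrightarrow> set (kept_edges S es) = E \<inter> S"
  by (auto simp: edge_stream_def kept_edges_def)

text \<open>\<open>I\<close> is the set in which a single run is likely to land, and
  \<open>Z\<close> the set of acceptable outcomes. Accuracy and rejection of the guess are both
  instances. Success is only counted when the coin shows \<open>True\<close>, which yields the
  factor \<open>\<beta>\<close>.\<close>

lemma median_sampler_success:
  assumes E: "edge_stream E es" and \<beta>: "0 \<le> \<beta>" "\<beta> \<le> 1"
    and bad: "measure_pmf.prob (colouring_pmf V q N) {c. run_estimate V q N c E \<notin> I} \<le> 1 / 8"
    and conv: "\<And>a b x. a \<in> I \<Longrightarrow> b \<in> I \<Longrightarrow> a \<le> x \<Longrightarrow> x \<le> b \<Longrightarrow> x \<in> I"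
    and Z: "\<And>M. M \<in> I \<Longrightarrow> (if M < \<tau> then Guess_Too_Large else Estimate M) \<in> Z"
  shows "\<beta> * (1 - (1 / 2) ^ l) \<le> measure_pmf.prob (outcome_pmf (median_sampler V q N l \<beta> \<tau>) es) Z"
proof -
  let ?R = "Pi_pmf {..<2 * l} (\<lambda>_. 0) (\<lambda>_. colouring_pmf V q N)"
  let ?B = "{c. run_estimate V q N c E \<notin> I}"
  define Bad where "Bad = {\<omega>. l \<le> card {i. i < 2 * l \<and> \<omega> i \<in> ?B}}"
  define out where "out \<omega> = (let M = upper_median (2 * l)
      (\<lambda>i. run_estimate V q N (\<omega> i) (E \<inter> (\<Union>i<2 * l. colour_edges V N (\<omega> i))))
    in if M < \<tau> then Guess_Too_Large else Estimate M)" for \<omega>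
  have "measure_pmf.prob ?R Bad \<le> (1 / 2) ^ l"
    unfolding Bad_def by (rule prob_half_bad_le[OF bad])
  moreover have "measure_pmf.prob ?R (- Bad) = 1 - measure_pmf.prob ?R Bad"
    using measure_pmf.prob_compl[of Bad ?R] by (simp add: Compl_eq_Diff_UNIV)
  ultimately have "\<beta> * (1 - (1 / 2) ^ l) \<le> \<beta> * measure_pmf.prob ?R (- Bad)"
    using \<beta> by (intro mult_left_mono) auto
  also have "\<dots> = measure_pmf.prob (pair_pmf (bernoulli_pmf \<beta>) ?R) ({True} \<times> (- Bad))"
    using \<beta> by (simp add: prob_pair_pmf measure_pmf_single)
  also have "\<dots> \<le> measure_pmf.prob (pair_pmf (bernoulli_pmf \<beta>) ?R)
      ((\<lambda>(b, \<omega>). if b then out \<omega> else Guess_Too_Large) -` Z)"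
  proof (rule measure_pmf.finite_measure_mono)
    have "out \<omega> \<in> Z" if "\<omega> \<notin> Bad" for \<omega>
    proof -
      let ?f = "\<lambda>i. run_estimate V q N (\<omega> i) (E \<inter> (\<Union>i<2 * l. colour_edges V N (\<omega> i)))"
      \<comment> \<open>All runs see the union of the samples, but run \<open>i\<close> intersects
        it with its own \<open>colour_edges\<close>, so the other runs do not disturb it.\<close>
      have f: "?f i = run_estimate V q N (\<omega> i) E" if "i < 2 * l" for i
      proof -
        have "E \<inter> (\<Union>i<2 * l. colour_edges V N (\<omega> i)) \<inter> colour_edges V N (\<omega> i)
            = E \<inter> colour_edges V N (\<omega> i)" using that by blast
        thus ?thesis by (simp add: run_estimate_def)
      qed
      have "card {i. i < 2 * l \<and> ?f i \<in> I} + card {i. i < 2 * l \<and> \<omega> i \<in> ?B}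
          = card ({i. i < 2 * l \<and> ?f i \<in> I} \<union> {i. i < 2 * l \<and> \<omega> i \<in> ?B})"
        using f by (intro card_Un_disjoint[symmetric]) auto
      also have "{i. i < 2 * l \<and> ?f i \<in> I} \<union> {i. i < 2 * l \<and> \<omega> i \<in> ?B} = {..<2 * l}"
        using f by auto
      finally have "2 * l < 2 * card {i. i < 2 * l \<and> ?f i \<in> I}"
        using that by (simp add: Bad_def)
      hence "upper_median (2 * l) ?f \<in> I" using conv by (rule upper_median_mem)
      thus ?thesis using Z by (simp add: out_def Let_def)
    qed
    thus "{True} \<times> (- Bad) \<subseteq> (\<lambda>(b, \<omega>). if b then out \<omega> else Guess_Too_Large) -` Z" by auto
  qed simp
  also have "\<dots> = measure_pmf.prob (outcome_pmf (median_sampler V q N l \<beta> \<tau>) es) Z"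
    unfolding outcome_pmf_def median_sampler_def map_pmf_comp measure_map_pmf
    by (intro arg_cong2[where f = measure] arg_cong2[where f = "vimage"] refl)
      (auto simp: fun_eq_iff out_def set_kept_edges[OF E] split: prod.splits)
  finally show ?thesis .
qed

lemma expected_kept_le:
  assumes E: "edge_stream E es"
    and p: "\<And>e. e \<in> E \<Longrightarrow> measure_pmf.prob A {(S, g). e \<in> S} \<le> p"
  shows "expected_kept A es \<le> real (card E) * p"
proof -
  have "real (length (kept_edges S es)) = (\<Sum>e\<in>E. indicator {(S, g). e \<in> S} (S, g))"
    for S and g :: "'a set set \<Rightarrow> outcome"
  proof -
    have "length (kept_edges S es) = card (E \<inter> S)"
      using E distinct_card[of "kept_edges S es"] set_kept_edges[OF E]
      by (simp add: kept_edges_def edge_stream_def)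
    moreover have "finite E" using E by (auto simp: edge_stream_def)
    ultimately show ?thesis by (simp add: indicator_def Int_def)
  qed
  hence "expected_kept A es
      = measure_pmf.expectation A (\<lambda>x. \<Sum>e\<in>E. indicator {(S, g). e \<in> S} x)"
    unfolding expected_kept_def by (intro Bochner_Integration.integral_cong) auto
  also have "\<dots> = (\<Sum>e\<in>E. measure_pmf.expectation A (indicator {(S, g). e \<in> S}))"
    by (rule Bochner_Integration.integral_sum) (simp add: measure_pmf.emeasure_eq_measure)
  also have "\<dots> \<le> (\<Sum>e\<in>E. p)" using p by (intro sum_mono) simp
  finally show ?thesis by simp
qed

text \<open>One run keeps an edge with probability \<open>N * (q / N)^2 = q^2 / N\<close>; a union
  bound over the \<open>2 * l\<close> runs and the independent coin give the rest.\<close>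

lemma expected_kept_median_sampler:
  assumes G: "simple_graph V E" "edge_stream E es" and \<beta>: "0 \<le> \<beta>" "\<beta> \<le> 1"
    and q: "0 < q" "q \<le> 1"
  shows "expected_kept (median_sampler V q N l \<beta> \<tau>) es
    \<le> real (card E) * (\<beta> * (2 * real l * (q\<^sup>2 / real N)))"
proof (rule expected_kept_le[OF G(2)])
  fix e assume e: "e \<in> E"
  have V: "finite V" and e2: "e \<subseteq> V" "card e = 2"
    using G(1) e by (auto simp: simple_graph_def vertex_pairs_def)
  have "e \<noteq> {}" using e2 by auto
  let ?R = "Pi_pmf {..<2 * l} (\<lambda>_. 0) (\<lambda>_. colouring_pmf V q N)"
  have one: "measure_pmf.prob ?R {\<omega>. e \<in> colour_edges V N (\<omega> i)} \<le> q\<^sup>2 / real N" if "i < 2 * l" for i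
  proof -
    have "measure_pmf.prob ?R {\<omega>. e \<in> colour_edges V N (\<omega> i)}
        = measure_pmf.prob (map_pmf (\<lambda>\<omega>. \<omega> i) ?R) {c. e \<in> colour_edges V N c}"
      by (simp add: vimage_def)
    also have "map_pmf (\<lambda>\<omega>. \<omega> i) ?R = colouring_pmf V q N"
      using that by (simp add: Pi_pmf_component)
    also have "measure_pmf.prob (colouring_pmf V q N) {c. e \<in> colour_edges V N c}
        = measure_pmf.prob (colouring_pmf V q N) {c. monochromatic N c e}"
      using e2 by (simp add: colour_edges_def vertex_pairs_def)
    also have "\<dots> = real N * (q / real N)\<^sup>2"
      using prob_monochromatic[OF V e2(1) \<open>e \<noteq> {}\<close> q] e2(2) by simp
    finally show ?thesis by (simp add: power2_eq_square)
  qed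
  have "measure_pmf.prob (median_sampler V q N l \<beta> \<tau>) {(S, g). e \<in> S}
      = measure_pmf.prob (pair_pmf (bernoulli_pmf \<beta>) ?R)
          ({True} \<times> {\<omega>. e \<in> (\<Union>i<2 * l. colour_edges V N (\<omega> i))})"
    unfolding median_sampler_def measure_map_pmf
    by (intro arg_cong2[where f = measure] refl) (auto split: if_splits)
  also have "\<dots> = \<beta> * measure_pmf.prob ?R {\<omega>. e \<in> (\<Union>i<2 * l. colour_edges V N (\<omega> i))}"
    using \<beta> by (simp add: prob_pair_pmf measure_pmf_single)
  also have "\<dots> \<le> \<beta> * (2 * real l * (q\<^sup>2 / real N))"
  proof (rule mult_left_mono[OF _ \<beta>(1)])
    have "{\<omega>. e \<in> (\<Union>i<2 * l. colour_edges V N (\<omega> i))}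
        = (\<Union>i<2 * l. {\<omega>. e \<in> colour_edges V N (\<omega> i)})" by auto
    hence "measure_pmf.prob ?R {\<omega>. e \<in> (\<Union>i<2 * l. colour_edges V N (\<omega> i))}
        \<le> (\<Sum>i<2 * l. measure_pmf.prob ?R {\<omega>. e \<in> colour_edges V N (\<omega> i)})"
      by (simp, intro measure_pmf.finite_measure_subadditive_finite) auto
    also have "\<dots> \<le> (\<Sum>i<2 * l. q\<^sup>2 / real N)" by (intro sum_mono one) auto
    finally show "measure_pmf.prob ?R {\<omega>. e \<in> (\<Union>i<2 * l. colour_edges V N (\<omega> i))}
        \<le> 2 * real l * (q\<^sup>2 / real N)" by simp
  qed
  finally show "measure_pmf.prob (median_sampler V q N l \<beta> \<tau>) {(S, g). e \<in> S}
    \<le> \<beta> * (2 * real l * (q\<^sup>2 / real N))" .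
qed

section \<open>Choice of the sampling rates\<close>

text \<open>The targets are an edge sampling probability \<open>r = q\<^sup>2 / N\<close> and a vertex sampling probability
  \<open>q\<close>. The variance contributions of a single triangle, of a shared edge and of a shared vertex are
  \<open>q / r\<^sup>2\<close>, \<open>\<Delta>\<^sub>E / r\<close> and \<open>\<Delta>\<^sub>V (1 / q - 1)\<close>, and all of them have to be small compared to
  \<open>\<epsilon>\<^sup>2 T\<close>; the arguments \<open>x\<close> and \<open>y\<close> are upper bounds for \<open>\<Delta>\<^sub>V\<close> and \<open>\<Delta>\<^sub>E\<close>.\<close>

definition edge_rate :: "real \<Rightarrow> real \<Rightarrow> real \<Rightarrow> real \<Rightarrow> real" where
  "edge_rate \<epsilon> T x y = 1000000 / \<epsilon>\<^sup>2 * (1 / T powr (2/3) + sqrt x / T + y / T)"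

text \<open>The first argument of \<open>max\<close> controls the variance from shared vertices. The
  second ensures \<open>r \<le> q^2\<close> when \<open>r < 1\<close>, which leaves room for at
  least one colour. The constant is \<open>829440 = 3 * 276480\<close>.\<close>

definition vertex_rate :: "real \<Rightarrow> real \<Rightarrow> real \<Rightarrow> real \<Rightarrow> real" where
  "vertex_rate \<epsilon> T x y = min 1 (max (829440 * x / (\<epsilon>\<^sup>2 * T)) (sqrt (edge_rate \<epsilon> T x y)))"

text \<open>Rounding \<open>q^2 / r\<close> down makes the actual edge probability
  \<open>q^2 / N\<close> at least \<open>r\<close> unless \<open>r\<close> is saturated.\<close>

definition num_colours :: "real \<Rightarrow> real \<Rightarrow> real \<Rightarrow> real \<Rightarrow> nat" where
  "num_colours \<epsilon> T x y = max 1 (nat \<lfloor>(vertex_rate \<epsilon> T x y)\<^sup>2 / edge_rate \<epsilon> T x y\<rfloor>)"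

context
  fixes \<epsilon> T x y r q :: real and N :: nat
  assumes \<epsilon>: "0 < \<epsilon>" "\<epsilon> < 1" and T: "0 < T" and x: "0 \<le> x" and y: "0 \<le> y"
  defines "r \<equiv> edge_rate \<epsilon> T x y" and "q \<equiv> vertex_rate \<epsilon> T x y" and "N \<equiv> num_colours \<epsilon> T x y"
begin

lemma edge_rate_ge:
  "1000000 / (\<epsilon>\<^sup>2 * T powr (2/3)) \<le> r" "1000000 * sqrt x / (\<epsilon>\<^sup>2 * T) \<le> r" "1000000 * y / (\<epsilon>\<^sup>2 * T) \<le> r"
proof -
  have "0 \<le> 1000000 / (\<epsilon>\<^sup>2 * T powr (2/3))" "0 \<le> 1000000 * sqrt x / (\<epsilon>\<^sup>2 * T)"
    "0 \<le> 1000000 * y / (\<epsilon>\<^sup>2 * T)" using \<epsilon> T x y by auto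
  moreover have "r = 1000000 / (\<epsilon>\<^sup>2 * T powr (2/3)) + 1000000 * sqrt x / (\<epsilon>\<^sup>2 * T) + 1000000 * y / (\<epsilon>\<^sup>2 * T)"
    by (simp add: r_def edge_rate_def algebra_simps add_divide_distrib)
  ultimately show "1000000 / (\<epsilon>\<^sup>2 * T powr (2/3)) \<le> r" "1000000 * sqrt x / (\<epsilon>\<^sup>2 * T) \<le> r"
    "1000000 * y / (\<epsilon>\<^sup>2 * T) \<le> r" by linarith+
qed

lemma edge_rate_pos: "0 < r"
  using edge_rate_ge(1) \<epsilon> T by (intro less_le_trans[OF _ edge_rate_ge(1)]) simp

lemma vertex_rate_bounds: "0 < q" "q \<le> 1"
  using edge_rate_pos by (auto simp: q_def vertex_rate_def r_def less_max_iff_disj)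

lemma num_colours_ge: "1 \<le> N"
  by (simp add: N_def num_colours_def)

text \<open>Rounding costs at most a factor 2, since both the floor and 1 are bounded by
  \<open>N\<close>.\<close>

lemma effective_rate_le: "q\<^sup>2 / real N \<le> min 1 (2 * r)"
proof -
  have "q\<^sup>2 \<le> 1" using vertex_rate_bounds by (simp add: power_le_one)
  also have "1 \<le> real N" using num_colours_ge by simp
  finally have 1: "q\<^sup>2 / real N \<le> 1" using num_colours_ge by (simp add: divide_le_eq)
  have "q\<^sup>2 / r < real_of_int \<lfloor>q\<^sup>2 / r\<rfloor> + 1" by linarith
  also have "\<dots> \<le> real N + real N"
    using num_colours_ge by (intro add_mono) (auto simp: N_def num_colours_def r_def q_def)
  finally have "q\<^sup>2 / real N \<le> 2 * r"
    using edge_rate_pos num_colours_ge by (simp add: field_simps)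
  thus ?thesis using 1 by simp
qed

lemma rates_saturated:
  assumes "1 \<le> r"
  shows "q = 1" "N = 1"
proof -
  have "1 \<le> sqrt r" using assms by simp
  hence "1 \<le> max (829440 * x / (\<epsilon>\<^sup>2 * T)) (sqrt r)" by (simp add: le_max_iff_disj)
  thus q1: "q = 1" by (simp only: q_def vertex_rate_def r_def min_absorb1)
  have "\<lfloor>1 / r\<rfloor> \<le> 1" using assms edge_rate_pos by (simp add: floor_le_iff field_simps)
  hence "nat \<lfloor>1 / r\<rfloor> \<le> 1" by linarith
  moreover have "N = max 1 (nat \<lfloor>q\<^sup>2 / r\<rfloor>)" by (simp only: N_def num_colours_def r_def q_def)
  ultimately show "N = 1" using q1 by (simp add: max_absorb1)
qed

lemma effective_rate_ge:
  assumes "r < 1"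
  shows "r \<le> q\<^sup>2 / real N"
proof -
  have "sqrt r \<le> q" using assms by (auto simp: q_def vertex_rate_def r_def)
  hence "r \<le> q\<^sup>2" using edge_rate_pos by (simp add: sqrt_le_D)
  hence z: "1 \<le> q\<^sup>2 / r" using edge_rate_pos by (simp add: field_simps)
  hence "real N = real_of_int \<lfloor>q\<^sup>2 / r\<rfloor>"
    by (auto simp: N_def num_colours_def r_def q_def le_nat_iff le_floor_iff max_def not_le nat_less_iff)
  hence "real N \<le> q\<^sup>2 / r" by simp
  thus ?thesis using edge_rate_pos num_colours_ge by (simp add: field_simps)
qed

text \<open>This bounds \<open>q / r^2\<close>, the variance of single triangles. If
  \<open>q\<close> is limited by the term with \<open>x\<close>, the summand
  \<open>sqrt x / T\<close> of the edge rate suffices, since \<open>276480 * 829440 < 10^12\<close>.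
  If \<open>q \<le> sqrt r\<close>, the summand \<open>1 / T powr (2/3)\<close> does, as it makes
  \<open>r^(3/2)\<close> at least \<open>10^9 / (\<epsilon>^3 * T)\<close>.\<close>

lemma vertex_rate_le_edge_rate_sq: "276480 * q \<le> \<epsilon>\<^sup>2 * T * r\<^sup>2"
proof -
  consider "q \<le> 829440 * x / (\<epsilon>\<^sup>2 * T)" | "q \<le> sqrt r"
    unfolding q_def vertex_rate_def r_def by linarith
  thus ?thesis
  proof cases
    case 1
    have "(1000000 * sqrt x / (\<epsilon>\<^sup>2 * T))\<^sup>2 \<le> r\<^sup>2"
      using edge_rate_ge(2) \<epsilon> T x by (intro power_mono) auto
    hence "1000000\<^sup>2 * x / (\<epsilon>\<^sup>2 * T)\<^sup>2 \<le> r\<^sup>2"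
      using x by (simp add: power_divide power_mult_distrib)
    hence "\<epsilon>\<^sup>2 * T * (1000000\<^sup>2 * x / (\<epsilon>\<^sup>2 * T)\<^sup>2) \<le> \<epsilon>\<^sup>2 * T * r\<^sup>2"
      using \<epsilon> T by (intro mult_left_mono) auto
    also have "\<epsilon>\<^sup>2 * T * (1000000\<^sup>2 * x / (\<epsilon>\<^sup>2 * T)\<^sup>2) = 1000000000000 * (x / (\<epsilon>\<^sup>2 * T))"
      using \<epsilon> T by (simp add: power2_eq_square field_simps)
    finally have "1000000000000 * (x / (\<epsilon>\<^sup>2 * T)) \<le> \<epsilon>\<^sup>2 * T * r\<^sup>2" .
    moreover have "276480 * q \<le> 276480 * (829440 * (x / (\<epsilon>\<^sup>2 * T)))" using 1 by simp
    moreover have "276480 * (829440 * (x / (\<epsilon>\<^sup>2 * T))) \<le> 1000000000000 * (x / (\<epsilon>\<^sup>2 * T))"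
      using \<epsilon> T x by (simp add: divide_right_mono)
    ultimately show ?thesis by (blast intro: order_trans)
  next
    case 2
    \<comment> \<open>The square root of \<open>r\<close> and the cube root of \<open>T\<close> turn
      all exponents into integers.\<close>
    define s where "s = sqrt r"
    define u where "u = T powr (1/3)"
    have s: "0 < s" "s\<^sup>2 = r" using edge_rate_pos by (auto simp: s_def)
    have u: "0 < u" "u ^ 3 = T" "T powr (2/3) = u\<^sup>2"
      using T by (auto simp: u_def powr_powr simp flip: powr_numeral)
    have "(1000 / (\<epsilon> * u))\<^sup>2 \<le> s\<^sup>2"
      using edge_rate_ge(1) by (simp add: s u power_divide power_mult_distrib)
    hence "1000 / (\<epsilon> * u) \<le> s" using s(1) by (rule power2_le_imp_le[OF _ less_imp_le])
    hence "(1000 / (\<epsilon> * u)) ^ 3 \<le> s ^ 3" using \<epsilon> u by (intro power_mono) auto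
    hence "\<epsilon>\<^sup>2 * T * (1000 / (\<epsilon> * u)) ^ 3 \<le> \<epsilon>\<^sup>2 * T * s ^ 3"
      using T by (intro mult_left_mono) auto
    moreover have "\<epsilon>\<^sup>2 * T * (1000 / (\<epsilon> * u)) ^ 3 = 1000000000 / \<epsilon>"
      using \<epsilon> u(1) by (simp add: u(2)[symmetric] power2_eq_square power3_eq_cube field_simps)
    moreover have "276480 \<le> 1000000000 / \<epsilon>" using \<epsilon> by (simp add: field_simps)
    ultimately have "276480 \<le> \<epsilon>\<^sup>2 * T * s ^ 3" by linarith
    hence "276480 * s \<le> \<epsilon>\<^sup>2 * T * s ^ 3 * s" using s(1) by (intro mult_right_mono) auto
    also have "\<dots> = \<epsilon>\<^sup>2 * T * r\<^sup>2" by (simp add: s(2)[symmetric] power2_eq_square power3_eq_cube)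
    finally show ?thesis using 2 by (simp add: s_def)
  qed
qed

text \<open>Each of the three terms receives a third of the budget:
  \<open>276480 = 3 * 92160\<close>.\<close>

lemma variance_bound:
  assumes "r < 1" and dV: "0 \<le> dV" "dV \<le> x" and dE: "0 \<le> dE" "dE \<le> y"
  shows "(real N)\<^sup>2 / q ^ 3 + 3 * dE * (real N / q\<^sup>2) + 3 * dV * (1 / q - 1) \<le> \<epsilon>\<^sup>2 * T / 92160"
proof -
  define z where "z = q\<^sup>2 / real N"
  note q = vertex_rate_bounds
  have N: "0 < real N" using num_colours_ge by simp
  have z: "r \<le> z" "0 < z" using effective_rate_ge[OF assms(1)] edge_rate_pos by (auto simp: z_def)
  have \<epsilon>T: "0 < \<epsilon>\<^sup>2 * T" using \<epsilon> T by simp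
  have "(real N)\<^sup>2 / q ^ 3 = q / z\<^sup>2"
    using q N by (simp add: z_def power2_eq_square power3_eq_cube field_simps)
  also have "\<dots> \<le> q / r\<^sup>2"
    using z edge_rate_pos q by (intro divide_left_mono power_mono mult_pos_pos) auto
  also have "\<dots> \<le> \<epsilon>\<^sup>2 * T / 276480"
    using vertex_rate_le_edge_rate_sq edge_rate_pos by (simp add: field_simps)
  finally have 1: "(real N)\<^sup>2 / q ^ 3 \<le> \<epsilon>\<^sup>2 * T / 276480" .
  have "1000000 * y \<le> r * (\<epsilon>\<^sup>2 * T)"
    using edge_rate_ge(3) \<epsilon>T by (simp add: pos_divide_le_eq)
  also have "\<dots> \<le> z * (\<epsilon>\<^sup>2 * T)" using z \<epsilon>T by (intro mult_right_mono) auto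
  finally have "829440 * dE \<le> z * (\<epsilon>\<^sup>2 * T)" using dE by linarith
  hence "3 * dE / z \<le> \<epsilon>\<^sup>2 * T / 276480"
    using z by (simp add: field_simps)
  hence 2: "3 * dE * (real N / q\<^sup>2) \<le> \<epsilon>\<^sup>2 * T / 276480" by (simp add: z_def)
  have 3: "3 * dV * (1 / q - 1) \<le> \<epsilon>\<^sup>2 * T / 276480"
  \<comment> \<open>The cap at 1 may push \<open>q\<close> below the value demanded by
    \<open>x\<close>, but then \<open>1 / q - 1\<close> vanishes.\<close>
  proof (cases "q = 1")
    case True
    thus ?thesis using \<epsilon>T by simp
  next
    case False
    hence "829440 * x / (\<epsilon>\<^sup>2 * T) \<le> q"
      by (auto simp: q_def vertex_rate_def min_def split: if_splits)
    hence "829440 * x \<le> q * (\<epsilon>\<^sup>2 * T)" using \<epsilon>T by (simp add: pos_divide_le_eq)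
    hence "829440 * dV \<le> q * (\<epsilon>\<^sup>2 * T)" using dV by linarith
    hence "3 * dV / q \<le> \<epsilon>\<^sup>2 * T / 276480" using q by (simp add: field_simps)
    moreover have "3 * dV * (1 / q - 1) \<le> 3 * dV / q" using dV by (simp add: field_simps)
    ultimately show ?thesis by linarith
  qed
  show ?thesis using 1 2 3 by linarith
qed

end

lemma run_estimate_accurate_rates:
  fixes V :: "'v set"
  assumes G: "simple_graph V E" and \<epsilon>: "0 < \<epsilon>" "\<epsilon> < 1" and T': "0 < T'"
    and le: "T' \<le> 16 * real (num_triangles V E)"
    and x: "real (Delta_V V E (\<epsilon> / 24)) \<le> x" and y: "real (Delta_E V E (\<epsilon> / 24)) \<le> y"
  defines "q \<equiv> vertex_rate \<epsilon> T' x y" and "N \<equiv> num_colours \<epsilon> T' x y"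
  shows "measure_pmf.prob (colouring_pmf V q N)
    {c. run_estimate V q N c E \<notin> {(1 - \<epsilon> / 6) * real (num_triangles V E) .. (1 + \<epsilon>) * real (num_triangles V E)}}
    \<le> 1 / 8"
proof -
  let ?T = "real (num_triangles V E)"
  have xy: "0 \<le> x" "0 \<le> y" using x y by linarith+
  have T0: "0 < ?T" using T' le by linarith
  show ?thesis
  proof (cases "1 \<le> edge_rate \<epsilon> T' x y")
    case True
    hence qN: "q = 1" "N = 1"
      unfolding q_def N_def using rates_saturated[OF \<epsilon> T' xy] by auto
    have "{c. run_estimate V q N c E \<notin> {(1 - \<epsilon> / 6) * ?T .. (1 + \<epsilon>) * ?T}}
        \<subseteq> {c. run_estimate V 1 1 c E \<noteq> ?T}"
      using \<epsilon> T0 by (auto simp: qN algebra_simps)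
    hence "measure_pmf.prob (colouring_pmf V q N)
        {c. run_estimate V q N c E \<notin> {(1 - \<epsilon> / 6) * ?T .. (1 + \<epsilon>) * ?T}}
        \<le> measure_pmf.prob (colouring_pmf V 1 1) {c. run_estimate V 1 1 c E \<noteq> ?T}"
      unfolding qN by (intro measure_pmf.finite_measure_mono) auto
    thus ?thesis using run_estimate_exact[OF G] by simp
  next
    case False
    hence "edge_rate \<epsilon> T' x y < 1" by simp
    note variance_bound[OF \<epsilon> T' xy this of_nat_0_le_iff x of_nat_0_le_iff y, folded q_def N_def]
    \<comment> \<open>The slack \<open>92160 = 16 * 5760\<close> pays for guesses up to 16 times too
      large.\<close>
    also have "\<epsilon>\<^sup>2 * T' / 92160 \<le> \<epsilon>\<^sup>2 * (16 * ?T) / 92160"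
      using le by (intro divide_right_mono mult_left_mono) auto
    also have "\<dots> = \<epsilon>\<^sup>2 * ?T / 5760" by simp
    finally have var: "(real N)\<^sup>2 / q ^ 3 + 3 * real (Delta_E V E (\<epsilon> / 24)) * (real N / q\<^sup>2)
      + 3 * real (Delta_V V E (\<epsilon> / 24)) * (1 / q - 1) \<le> \<epsilon>\<^sup>2 * ?T / 5760" .
    have "0 < q" "q \<le> 1" "1 \<le> N"
      using vertex_rate_bounds[OF \<epsilon> T' xy] num_colours_ge[OF \<epsilon> T' xy] by (auto simp: q_def N_def)
    from run_estimate_accurate[OF G this \<epsilon> _ var] show ?thesis using T0 by simp
  qed
qed

section \<open>Number of runs\<close>

definition run_count :: "real \<Rightarrow> nat" where
  "run_count \<delta> = nat \<lceil>log 2 (1 / \<delta>)\<rceil>"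

definition thinning :: "real \<Rightarrow> real" where
  "thinning \<delta> = min 1 (2 * (1 - \<delta>))"

context
  fixes \<delta> :: real
  assumes \<delta>: "0 < \<delta>" "\<delta> < 1"
begin

lemma thinning_bounds: "0 \<le> thinning \<delta>" "thinning \<delta> \<le> 1"
  using \<delta> by (auto simp: thinning_def)

lemma log_inverse_pos: "0 < log 2 (1 / \<delta>)"
  using \<delta> by simp

text \<open>For \<open>\<delta> \<le> 1 / 2\<close> the coin is certain and
  \<open>(1 / 2) ^ run_count \<delta> \<le> \<delta>\<close>. Otherwise the median succeeds with
  probability at least \<open>1 / 2\<close>, and the coin shows \<open>True\<close> with probability
  \<open>2 * (1 - \<delta>)\<close>.\<close>

lemma thinned_success: "1 - \<delta> \<le> thinning \<delta> * (1 - (1 / 2) ^ run_count \<delta>)"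
proof -
  have "1 / \<delta> = 2 powr (log 2 (1 / \<delta>))" using \<delta> by simp
  also have "\<dots> \<le> 2 powr real (run_count \<delta>)"
    by (intro powr_mono) (auto simp: run_count_def le_nat_iff real_nat_ceiling_ge)
  also have "\<dots> = 2 ^ run_count \<delta>" by (simp add: powr_realpow)
  finally have 1: "(1 / 2) ^ run_count \<delta> \<le> \<delta>"
    using \<delta> by (simp add: field_simps power_divide)
  have "1 \<le> run_count \<delta>" using log_inverse_pos by (simp add: run_count_def Suc_le_eq)
  hence "(1 / 2 :: real) ^ run_count \<delta> \<le> (1 / 2) ^ 1" by (intro power_decreasing) auto
  hence 2: "1 / 2 \<le> 1 - (1 / 2 :: real) ^ run_count \<delta>" by simp
  show ?thesis
  proof (cases "\<delta> \<le> 1 / 2")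
    case True
    thus ?thesis using 1 by (simp add: thinning_def)
  next
    case False
    hence "thinning \<delta> = 2 * (1 - \<delta>)" by (simp add: thinning_def)
    moreover have "2 * (1 - \<delta>) * (1 / 2) \<le> 2 * (1 - \<delta>) * (1 - (1 / 2) ^ run_count \<delta>)"
      using \<delta> by (intro mult_left_mono 2) auto
    ultimately show ?thesis by simp
  qed
qed

text \<open>For \<open>\<delta> \<le> 1 / 2\<close> the logarithm is at least 1 and absorbs the
  rounding. Otherwise there are at most four runs, thinned to \<open>8 * (1 - \<delta>)\<close> in
  expectation, and \<open>1 - \<delta> \<le> ln (1 / \<delta>)\<close>.\<close>

lemma thinned_runs_le: "thinning \<delta> * (2 * real (run_count \<delta>)) \<le> 8 * ln (1 / \<delta>)"
proof -
  let ?b = "log 2 (1 / \<delta>)"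
  have l: "real (run_count \<delta>) \<le> ?b + 1"
    using log_inverse_pos by (simp add: run_count_def)
  have ln2: "1 / 2 \<le> ln (2 :: real)" using ln_le_minus_one[of "1 / 2"] by (simp add: ln_div)
  show ?thesis
  proof (cases "\<delta> \<le> 1 / 2")
    case True
    have "1 \<le> ?b" using True \<delta> by (simp add: le_log_iff field_simps)
    hence "thinning \<delta> * (2 * real (run_count \<delta>)) \<le> 4 * ?b"
      using l True by (simp add: thinning_def)
    also have "\<dots> = 4 * ln (1 / \<delta>) / ln 2" by (simp add: log_def)
    also have "\<dots> \<le> 4 * ln (1 / \<delta>) / (1 / 2)"
      using \<delta> ln2 by (intro divide_left_mono) auto
    finally show ?thesis by simp
  next
    case False
    have "?b \<le> 1" using False \<delta> by (simp add: log_le_iff field_simps)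
    hence "real (run_count \<delta>) \<le> 2" using l by linarith
    hence "thinning \<delta> * (2 * real (run_count \<delta>)) \<le> 2 * (1 - \<delta>) * 4"
      using \<delta> by (intro mult_mono) (auto simp: thinning_def)
    moreover have "1 - \<delta> \<le> ln (1 / \<delta>)"
      using ln_le_minus_one[OF \<delta>(1)] \<delta> by (simp add: ln_div)
    ultimately show ?thesis by simp
  qed
qed

end

section \<open>The final sampler, its guarantee and its sample count\<close>

lemma min_edge_rate_le:
  assumes \<epsilon>: "0 < \<epsilon>" "\<epsilon> < 1" and T: "0 < T" and \<kappa>: "1 \<le> \<kappa>"
    and D: "0 \<le> DV" "0 \<le> DE" and x: "x \<le> \<kappa>\<^sup>2 * DV" and y: "y \<le> \<kappa>\<^sup>2 * DE"
  shows "min 1 (2 * edge_rate \<epsilon> T x y)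
    \<le> 2000000 * \<kappa>\<^sup>2 / \<epsilon>\<^sup>2 * (1 / T powr (2/3) + sqrt DV * ln (max 1 T) / T + DE * ln (max 1 T) / T)"
proof -
  let ?l = "ln (max 1 T)"
  have \<kappa>2: "1 \<le> \<kappa>\<^sup>2" "\<kappa> \<le> \<kappa>\<^sup>2" using \<kappa> by (auto simp: self_le_power)
  have l0: "0 \<le> ?l" by simp
  have \<epsilon>2: "0 < \<epsilon>\<^sup>2" "\<epsilon>\<^sup>2 \<le> 1" using \<epsilon> by (auto simp: power_le_one)
  show ?thesis
  \<comment> \<open>For small \<open>T\<close> the logarithm may vanish, but then
    \<open>1 / T powr (2/3)\<close> alone is at least \<open>1 / 3\<close> and the trivial bound 1
    on the rate suffices.\<close>
  proof (cases "T < 3")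
    case True
    have "T powr (2/3) \<le> 3 powr (2/3)" using True T by (intro powr_mono2) auto
    also have "\<dots> \<le> 3 powr 1" by (intro powr_mono) auto
    finally have "1 / 3 \<le> 1 / T powr (2/3)" using T by (simp add: field_simps)
    moreover have "0 \<le> sqrt DV * ?l / T" "0 \<le> DE * ?l / T"
      using D T l0 by (intro divide_nonneg_pos mult_nonneg_nonneg; simp)+
    ultimately have a: "1 / 3 \<le> 1 / T powr (2/3) + sqrt DV * ?l / T + DE * ?l / T" by linarith
    have "3 \<le> 2000000 * \<kappa>\<^sup>2 / \<epsilon>\<^sup>2" using \<kappa>2 \<epsilon>2 by (simp add: le_divide_eq)
    hence "3 * (1 / 3) \<le> 2000000 * \<kappa>\<^sup>2 / \<epsilon>\<^sup>2 * (1 / T powr (2/3) + sqrt DV * ?l / T + DE * ?l / T)"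
      using a by (intro mult_mono) auto
    thus ?thesis by (simp add: min_le_iff_disj)
  next
    case False
    hence T3: "3 \<le> T" by simp
    \<comment> \<open>Since \<open>exp 1 \<le> 3\<close>, the logarithm is at least 1 from here on,
      so the logarithmic factors only enlarge the bound.\<close>
    have "ln (exp 1) \<le> ln T" using T3 exp_le T by (subst ln_le_cancel_iff) auto
    hence l1: "1 \<le> ?l" using T3 by (simp add: max_def)
    have "sqrt x \<le> sqrt (\<kappa>\<^sup>2 * DV)" using x by simp
    also have "\<dots> = \<kappa> * sqrt DV" using \<kappa> by (simp add: real_sqrt_mult)
    also have "\<dots> \<le> \<kappa>\<^sup>2 * (sqrt DV * ?l)"
      using \<kappa>2 D l1 mult_left_mono[OF l1, of "sqrt DV"] by (intro mult_mono) auto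
    finally have 1: "sqrt x / T \<le> \<kappa>\<^sup>2 * (sqrt DV * ?l / T)" using T by (simp add: divide_right_mono)
    have "y \<le> \<kappa>\<^sup>2 * (DE * ?l)"
      using D l1 mult_left_mono[OF l1, of DE] by (intro order_trans[OF y] mult_left_mono) auto
    hence 2: "y / T \<le> \<kappa>\<^sup>2 * (DE * ?l / T)" using T by (simp add: divide_right_mono)
    have 3: "1 / T powr (2/3) \<le> \<kappa>\<^sup>2 * (1 / T powr (2/3))"
      using \<kappa>2 mult_right_mono[of 1 "\<kappa>\<^sup>2" "1 / T powr (2/3)"] by simp
    have "1 / T powr (2/3) + sqrt x / T + y / T
        \<le> \<kappa>\<^sup>2 * (1 / T powr (2/3) + sqrt DV * ?l / T + DE * ?l / T)"
      using 1 2 3 by (simp add: distrib_left)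
    hence "2000000 / \<epsilon>\<^sup>2 * (1 / T powr (2/3) + sqrt x / T + y / T)
        \<le> 2000000 / \<epsilon>\<^sup>2 * (\<kappa>\<^sup>2 * (1 / T powr (2/3) + sqrt DV * ?l / T + DE * ?l / T))"
      using \<epsilon>2 by (intro mult_left_mono) auto
    hence "2 * edge_rate \<epsilon> T x y
        \<le> 2000000 * \<kappa>\<^sup>2 / \<epsilon>\<^sup>2 * (1 / T powr (2/3) + sqrt DV * ?l / T + DE * ?l / T)"
      by (simp add: edge_rate_def)
    thus ?thesis by (simp add: min_le_iff_disj)
  qed
qed

text \<open>For \<open>\<epsilon> \<ge> 1\<close> the estimate 0 is already accurate and nothing is
  sampled. Scaling by \<open>\<kappa>\<close> turns parameters known up to the factor
  \<open>\<kappa>\<close> into upper bounds.\<close>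

definition triangle_sampler :: "real \<Rightarrow> 'v set \<Rightarrow> real \<Rightarrow> real \<Rightarrow> real \<Rightarrow> real \<Rightarrow> real \<Rightarrow> 'v sampler" where
  "triangle_sampler \<kappa> V \<epsilon> \<delta> T' dV dE =
     (if 1 \<le> \<epsilon> then return_pmf ({}, \<lambda>_. Estimate 0)
      else median_sampler V (vertex_rate \<epsilon> T' (\<kappa> * dV) (\<kappa> * dE)) (num_colours \<epsilon> T' (\<kappa> * dV) (\<kappa> * dE))
        (run_count \<delta>) (thinning \<delta>) (T' / 2))"

lemma sampler_on_triangle_sampler: "sampler_on V (triangle_sampler \<kappa> V \<epsilon> \<delta> T' dV dE)"
proof (cases "1 \<le> \<epsilon>")
  case True
  thus ?thesis by (simp add: triangle_sampler_def sampler_on_def)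
next
  case False
  thus ?thesis by (simp add: triangle_sampler_def sampler_on_median_sampler)
qed

text \<open>The first bound serves accuracy, the second the sample count.\<close>

lemma within_factor_scaled:
  assumes "1 \<le> \<kappa>" "within_factor \<kappa> D d"
  shows "D \<le> \<kappa> * d" "\<kappa> * d \<le> \<kappa>\<^sup>2 * D"
proof -
  have \<kappa>: "0 < \<kappa>" using assms(1) by simp
  thus "D \<le> \<kappa> * d"
    using assms(2) by (simp add: within_factor_def divide_le_eq mult.commute)
  show "\<kappa> * d \<le> \<kappa>\<^sup>2 * D"
    using assms(2) \<kappa> by (simp add: within_factor_def power2_eq_square mult.assoc)
qed

text \<open>The split is at \<open>T' = 16 * T\<close> rather than at \<open>T' = T\<close>: up to
  there the median is accurate, whether or not it is then rejected; beyond it, rejection itself is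
  likely.\<close>

lemma triangle_sampler_outcome:
  assumes \<kappa>: "1 \<le> \<kappa>" and \<epsilon>: "0 < \<epsilon>" and \<delta>: "0 < \<delta>" "\<delta> < 1" and T': "0 < T'"
    and G: "simple_graph V E" "edge_stream E es"
    and dV: "within_factor \<kappa> (real (Delta_V V E (\<epsilon> / 24))) dV"
    and dE: "within_factor \<kappa> (real (Delta_E V E (\<epsilon> / 24))) dE"
  shows "1 - \<delta> \<le> measure_pmf.prob (outcome_pmf (triangle_sampler \<kappa> V \<epsilon> \<delta> T' dV dE) es)
    (if T' \<le> real (num_triangles V E) then accurate \<epsilon> (real (num_triangles V E))
     else insert Guess_Too_Large (accurate \<epsilon> (real (num_triangles V E))))"
    (is "_ \<le> measure_pmf.prob _ ?Z")
proof (cases "1 \<le> \<epsilon>")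
  case True
  have "Estimate 0 \<in> accurate \<epsilon> (real (num_triangles V E))"
    using True by (auto simp: accurate_def mult_nonpos_nonneg)
  thus ?thesis
    using True \<delta> by (simp add: triangle_sampler_def outcome_pmf_def indicator_def)
next
  case False
  hence \<epsilon>1: "\<epsilon> < 1" by simp
  let ?T = "real (num_triangles V E)" and ?x = "\<kappa> * dV" and ?y = "\<kappa> * dE"
  define q where "q = vertex_rate \<epsilon> T' ?x ?y"
  define N where "N = num_colours \<epsilon> T' ?x ?y"
  note D = within_factor_scaled(1)[OF \<kappa> dV] within_factor_scaled(1)[OF \<kappa> dE]
  hence xy: "0 \<le> ?x" "0 \<le> ?y" by linarith+
  note success = median_sampler_success[OF G(2) thinning_bounds[OF \<delta>]]
  have "thinning \<delta> * (1 - (1 / 2) ^ run_count \<delta>)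
    \<le> measure_pmf.prob (outcome_pmf (median_sampler V q N (run_count \<delta>) (thinning \<delta>) (T' / 2)) es) ?Z"
  proof (cases "T' \<le> 16 * ?T")
    case True
    have "?T > 0" using True T' by linarith
    show ?thesis
    proof (rule success)
      show "measure_pmf.prob (colouring_pmf V q N)
          {c. run_estimate V q N c E \<notin> {(1 - \<epsilon> / 6) * ?T .. (1 + \<epsilon>) * ?T}} \<le> 1 / 8"
        unfolding q_def N_def by (rule run_estimate_accurate_rates[OF G(1) \<epsilon> \<epsilon>1 T' True D])
    next
      fix M assume M: "M \<in> {(1 - \<epsilon> / 6) * ?T .. (1 + \<epsilon>) * ?T}"
      have "(1 - \<epsilon>) * ?T \<le> (1 - \<epsilon> / 6) * ?T" using \<epsilon> by (intro mult_right_mono) auto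
      hence acc: "Estimate M \<in> accurate \<epsilon> ?T" using M by (auto simp: accurate_def)
      \<comment> \<open>A correct guess is never rejected when the median is accurate: it is at
        least \<open>T / 2\<close>, hence at least \<open>T' / 2\<close>.\<close>
      have "1 / 2 * ?T \<le> (1 - \<epsilon> / 6) * ?T" using \<epsilon>1 by (intro mult_right_mono) auto
      hence "T' / 2 \<le> M" if "T' \<le> ?T" using that M by auto
      thus "(if M < T' / 2 then Guess_Too_Large else Estimate M) \<in> ?Z" using acc by auto
    qed auto
  next
    case False
    show ?thesis
    proof (rule success)
      have "{c. run_estimate V q N c E \<notin> {..< T' / 2}} = {c. T' / 2 \<le> run_estimate V q N c E}" by auto
      hence "measure_pmf.prob (colouring_pmf V q N) {c. run_estimate V q N c E \<notin> {..< T' / 2}} \<le> ?T / (T' / 2)"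
        using run_estimate_markov[OF G(1), of q N "T' / 2"] T'
          vertex_rate_bounds[OF \<epsilon> \<epsilon>1 T' xy] num_colours_ge[OF \<epsilon> \<epsilon>1 T' xy]
        by (simp add: q_def N_def)
      also have "\<dots> \<le> 1 / 8" using False T' by (simp add: field_simps)
      finally show "measure_pmf.prob (colouring_pmf V q N) {c. run_estimate V q N c E \<notin> {..< T' / 2}} \<le> 1 / 8" .
    next
      have "\<not> T' \<le> ?T" using False by auto
      thus "(if M < T' / 2 then Guess_Too_Large else Estimate M) \<in> ?Z" if "M \<in> {..< T' / 2}" for M
        using that by auto
    qed auto
  qed
  thus ?thesis
    using thinned_success[OF \<delta>] False by (simp add: triangle_sampler_def q_def N_def)
qed

lemma expected_kept_triangle_sampler:
  assumes \<kappa>: "1 \<le> \<kappa>" and \<epsilon>: "0 < \<epsilon>" and \<delta>: "0 < \<delta>" "\<delta> < 1" and T': "0 < T'"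
    and G: "simple_graph V E" "edge_stream E es"
    and dV: "within_factor \<kappa> (real (Delta_V V E (\<epsilon> / 24))) dV"
    and dE: "within_factor \<kappa> (real (Delta_E V E (\<epsilon> / 24))) dE"
  shows "expected_kept (triangle_sampler \<kappa> V \<epsilon> \<delta> T' dV dE) es
    \<le> 16000000 * \<kappa>\<^sup>2 * sample_bound (real (card E)) \<epsilon> \<delta> T'
        (real (Delta_V V E (\<epsilon> / 24))) (real (Delta_E V E (\<epsilon> / 24)))"
proof (cases "1 \<le> \<epsilon>")
  case True
  have "expected_kept (triangle_sampler \<kappa> V \<epsilon> \<delta> T' dV dE) es = 0"
    using True by (simp add: triangle_sampler_def expected_kept_def kept_edges_def)
  moreover have "0 \<le> sample_bound (real (card E)) \<epsilon> \<delta> T'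
      (real (Delta_V V E (\<epsilon> / 24))) (real (Delta_E V E (\<epsilon> / 24)))"
    unfolding sample_bound_def using \<delta> T'
    by (intro mult_nonneg_nonneg add_nonneg_nonneg divide_nonneg_nonneg) auto
  ultimately show ?thesis by simp
next
  case False
  hence \<epsilon>1: "\<epsilon> < 1" by simp
  let ?x = "\<kappa> * dV" and ?y = "\<kappa> * dE"
  let ?DV = "real (Delta_V V E (\<epsilon> / 24))" and ?DE = "real (Delta_E V E (\<epsilon> / 24))"
  define q where "q = vertex_rate \<epsilon> T' ?x ?y"
  define N where "N = num_colours \<epsilon> T' ?x ?y"
  note D = within_factor_scaled[OF \<kappa> dV] within_factor_scaled[OF \<kappa> dE]
  hence xy: "0 \<le> ?x" "0 \<le> ?y" by linarith+
  define S where "S = 1 / T' powr (2/3) + sqrt ?DV * ln (max 1 T') / T' + ?DE * ln (max 1 T') / T'"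
  have "q\<^sup>2 / real N \<le> min 1 (2 * edge_rate \<epsilon> T' ?x ?y)"
    unfolding q_def N_def by (rule effective_rate_le[OF \<epsilon> \<epsilon>1 T' xy])
  also have "\<dots> \<le> 2000000 * \<kappa>\<^sup>2 / \<epsilon>\<^sup>2 * S"
    unfolding S_def by (rule min_edge_rate_le[OF \<epsilon> \<epsilon>1 T' \<kappa> _ _ D(2,4)]) auto
  finally have rate: "q\<^sup>2 / real N \<le> 2000000 * \<kappa>\<^sup>2 / \<epsilon>\<^sup>2 * S" .
  have "expected_kept (triangle_sampler \<kappa> V \<epsilon> \<delta> T' dV dE) es
      = expected_kept (median_sampler V q N (run_count \<delta>) (thinning \<delta>) (T' / 2)) es"
    using False by (simp add: triangle_sampler_def q_def N_def)
  also have "\<dots> \<le> real (card E) * (thinning \<delta> * (2 * real (run_count \<delta>) * (q\<^sup>2 / real N)))"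
    using vertex_rate_bounds[OF \<epsilon> \<epsilon>1 T' xy] thinning_bounds[OF \<delta>]
    by (intro expected_kept_median_sampler G) (auto simp: q_def)
  also have "\<dots> = real (card E) * ((thinning \<delta> * (2 * real (run_count \<delta>))) * (q\<^sup>2 / real N))"
    by simp
  \<comment> \<open>The final constant is the product of 8 from the thinned runs and 2000000 from
    the edge rate, doubled by rounding.\<close>
  also have "\<dots> \<le> real (card E) * (8 * ln (1 / \<delta>) * (2000000 * \<kappa>\<^sup>2 / \<epsilon>\<^sup>2 * S))"
    using \<delta> by (intro mult_left_mono mult_mono thinned_runs_le rate) auto
  also have "\<dots> = 16000000 * \<kappa>\<^sup>2 * sample_bound (real (card E)) \<epsilon> \<delta> T' ?DV ?DE"
    by (simp add: sample_bound_def S_def)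
  finally show ?thesis .
qed

theorem mainTheorem2:
  fixes \<kappa> :: real
  assumes "\<kappa> \<ge> 1"
  shows "\<exists>C > 0. \<exists>A :: 'v set \<Rightarrow> real \<Rightarrow> real \<Rightarrow> real \<Rightarrow> real \<Rightarrow> real \<Rightarrow> 'v sampler.
    \<forall>V \<epsilon> \<delta> T' dV dE. finite V \<longrightarrow> \<epsilon> > 0 \<longrightarrow> 0 < \<delta> \<longrightarrow> \<delta> < 1 \<longrightarrow> T' > 0 \<longrightarrow>
      sampler_on V (A V \<epsilon> \<delta> T' dV dE) \<and>
      (\<forall>E es. simple_graph V E \<longrightarrow> edge_stream E es \<longrightarrow>
        within_factor \<kappa> (real (Delta_V V E (\<epsilon> / 24))) dV \<longrightarrow>
        within_factor \<kappa> (real (Delta_E V E (\<epsilon> / 24))) dE \<longrightarrow>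
        (T' \<le> real (num_triangles V E) \<longrightarrow>
          measure_pmf.prob (outcome_pmf (A V \<epsilon> \<delta> T' dV dE) es)
            (accurate \<epsilon> (real (num_triangles V E))) \<ge> 1 - \<delta> \<and>
          expected_kept (A V \<epsilon> \<delta> T' dV dE) es
            \<le> C * sample_bound (real (card E)) \<epsilon> \<delta> T'
                  (real (Delta_V V E (\<epsilon> / 24))) (real (Delta_E V E (\<epsilon> / 24)))) \<and>
        (T' > real (num_triangles V E) \<longrightarrow>
          measure_pmf.prob (outcome_pmf (A V \<epsilon> \<delta> T' dV dE) es)
            (insert Guess_Too_Large (accurate \<epsilon> (real (num_triangles V E)))) \<ge> 1 - \<delta>))"
\<comment> \<open>The witness for \<open>C\<close> depends on \<open>\<kappa>\<close> alone; its
  square comes from replacing \<open>dV\<close> and \<open>dE\<close> by upper bounds.\<close>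
proof (intro exI[of _ "16000000 * \<kappa>\<^sup>2"] exI[of _ "triangle_sampler \<kappa>"] conjI allI impI)
  show "0 < 16000000 * \<kappa>\<^sup>2" using assms by simp
next
  fix V :: "'v set" and \<epsilon> \<delta> T' dV dE :: real
  show "sampler_on V (triangle_sampler \<kappa> V \<epsilon> \<delta> T' dV dE)" by (rule sampler_on_triangle_sampler)
next
  fix V :: "'v set" and \<epsilon> \<delta> T' dV dE :: real and E es
  assume a: "0 < \<epsilon>" "0 < \<delta>" "\<delta> < 1" "0 < T'" "simple_graph V E" "edge_stream E es"
    "within_factor \<kappa> (real (Delta_V V E (\<epsilon> / 24))) dV" "within_factor \<kappa> (real (Delta_E V E (\<epsilon> / 24))) dE"
  note outcome = triangle_sampler_outcome[OF assms a]
  show "1 - \<delta> \<le> measure_pmf.prob (outcome_pmf (triangle_sampler \<kappa> V \<epsilon> \<delta> T' dV dE) es)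
      (accurate \<epsilon> (real (num_triangles V E)))" if "T' \<le> real (num_triangles V E)"
    using outcome that by simp
  show "expected_kept (triangle_sampler \<kappa> V \<epsilon> \<delta> T' dV dE) es
      \<le> 16000000 * \<kappa>\<^sup>2 * sample_bound (real (card E)) \<epsilon> \<delta> T'
          (real (Delta_V V E (\<epsilon> / 24))) (real (Delta_E V E (\<epsilon> / 24)))"
    by (rule expected_kept_triangle_sampler[OF assms a])
  show "1 - \<delta> \<le> measure_pmf.prob (outcome_pmf (triangle_sampler \<kappa> V \<epsilon> \<delta> T' dV dE) es)
      (insert Guess_Too_Large (accurate \<epsilon> (real (num_triangles V E))))"
    if "real (num_triangles V E) < T'"
    using outcome that by simp
qed

end
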